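(* Let $\vec s\in\mathbb Z_{\le0}^k$. Then the limit $\lim_{\vec r\to-\vec s}\zeta(\vec s;\vec r)^{(\Sigma(\vec s))}$, taken over $\vec r\in\mathbb R_{>0}^k$, exists.
   Context: For $\vec s\in\mathbb Z^k$, $\vec r\in\mathbb R_{>0}^k$, $\mathrm{Re}\,\varepsilon<0$: $Z(\vec s;\vec r;\varepsilon)=\sum_{n_1>\dots>n_k>0}e^{\varepsilon(n_1r_1+\dots+n_kr_k)}n_1^{-s_1}\cdots n_k^{-s_k}$. For $\vec s\in\mathbb Z_{\le0}^k$ this is (the germ of) a convergent Laurent series in $\varepsilon$ at $0$, denoted $\overline Z(\vec s;\vec r;\varepsilon)\in R=\mathbb C[[\varepsilon,\varepsilon^{-1}]$ (formal Laurent series with finitely many negative powers); $\overline Z$ of the empty word is $1$. Let $P(\sum_na_n\varepsilon^n)=\sum_{n\le-1}a_n\varepsilon^n$. For a word $w=((s_1,r_1),\dots,(s_k,r_k))$ define recursively $\overline Z_-(w)=-P\big(\overline Z(w)+\sum_{j=1}^{k-1}\overline Z_-(w_{\le j})\overline Z(w_{>j})\big)$, $\overline Z_+(w)=(\mathrm{id}-P)\big(\overline Z(w)+\sum_{j=1}^{k-1}\overline Z_-(w_{\le j})\overline Z(w_{>j})\big)$ ($w_{\le j},w_{>j}$ the initial/final segments), and $\zeta(\vec s;\vec r)=\overline Z_+(\vec s;\vec r;\varepsilon)|_{\varepsilon=0}\in\mathbb C$. $\Sigma(\vec s)\subseteq\Sigma_k$ is the subgroup of permutations preserving each maximal block of consecutive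 indices $i$ with $s_i=0$ and fixing the other indices; $\sigma(\vec r)=(r_{\sigma(1)},\dots,r_{\sigma(k)})$ and $f(\vec r)^{(\Sigma(\vec s))}=\sum_{\sigma\in\Sigma(\vec s)}f(\sigma(\vec r))$. *)

theory Defs
  imports "HOL-Analysis.Analysis" "HOL-Computational_Algebra.Formal_Laurent_Series"
    "HOL-Combinatorics.Permutations"
begin

definition dec_tuples :: "nat \<Rightarrow> nat list set" where
  "dec_tuples k = {ns. length ns = k \<and> sorted_wrt (>) ns \<and> (\<forall>n\<in>set ns. 0 < n)}"

text \<open>Z(s;r;eps), for Re eps < 0, as an (absolutely convergent) sum.\<close>
definition Zfun :: "(int \<times> real) list \<Rightarrow> complex \<Rightarrow> complex" where
  "Zfun w \<epsilon> = (\<Sum>\<^sub>\<infinity> ns \<in> dec_tuples (length w).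
      exp (\<epsilon> * (\<Sum>i<length w. of_nat (ns ! i) * of_real (snd (w ! i))))
      * (\<Prod>i<length w. (of_nat (ns ! i) :: complex) powi (- fst (w ! i))))"

text \<open>F is a Laurent series converging on a punctured disc around 0 and agreeing there with f
 on the half plane Re eps < 0 (i.e. F is the germ at 0 of the Laurent expansion of f).\<close>
definition laurent_expansion_of :: "complex fls \<Rightarrow> (complex \<Rightarrow> complex) \<Rightarrow> bool" where
  "laurent_expansion_of F f \<longleftrightarrow> (\<exists>\<rho>>0. \<forall>\<epsilon>. 0 < norm \<epsilon> \<and> norm \<epsilon> < \<rho> \<and> Re \<epsilon> < 0 \<longrightarrow>
      (\<lambda>n. fls_nth F (int n + fls_subdegree F) * \<epsilon> powi (int n + fls_subdegree F)) sums f \<epsilon>)"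

definition Zbar :: "(int \<times> real) list \<Rightarrow> complex fls" where
  "Zbar w = (THE F. laurent_expansion_of F (Zfun w))"

abbreviation Ppart :: "complex fls \<Rightarrow> complex fls" where
  "Ppart F \<equiv> fls_prpart_as_fls F"

function Zminus :: "(int \<times> real) list \<Rightarrow> complex fls" where
  "Zminus w = - Ppart (Zbar w + (\<Sum>j\<in>{1..<length w}. Zminus (take j w) * Zbar (drop j w)))"
  by pat_completeness auto
termination by (relation "Wellfounded.measure length") auto

definition Zplus :: "(int \<times> real) list \<Rightarrow> complex fls" where
  "Zplus w = (let G = Zbar w + (\<Sum>j\<in>{1..<length w}. Zminus (take j w) * Zbar (drop j w))
              in G - Ppart G)"

definition zeta_reg :: "int list \<Rightarrow> real list \<Rightarrow> complex" where
  "zeta_reg s r = fls_nth (Zplus (zip s r)) 0"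

text \<open>Sigma(s): permutations of {0..<k} preserving each maximal block of consecutive
 indices with s_i = 0 and fixing the other indices.\<close>
definition Sigma_s :: "int list \<Rightarrow> (nat \<Rightarrow> nat) set" where
  "Sigma_s s = {p. p permutes {..<length s} \<and>
     (\<forall>i<length s. (s ! i \<noteq> 0 \<longrightarrow> p i = i) \<and>
        (s ! i = 0 \<longrightarrow> (\<forall>j. min i (p i) \<le> j \<and> j \<le> max i (p i) \<longrightarrow> s ! j = 0)))}"

definition perm_list :: "(nat \<Rightarrow> nat) \<Rightarrow> real list \<Rightarrow> real list" where
  "perm_list p r = map (\<lambda>i. r ! p i) [0..<length r]"

definition zeta_sym :: "int list \<Rightarrow> real list \<Rightarrow> complex" where
  "zeta_sym s r = (\<Sum>p\<in>Sigma_s s. zeta_reg s (perm_list p r))"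

end

theory Submission
  imports Defs "HOL-Complex_Analysis.Complex_Analysis" "HOL-Real_Asymp.Real_Asymp"
    "HOL-Combinatorics.Multiset_Permutations"
begin

text \<open>Writing \<open>n\<^sub>i\<close> as a sum of successive gaps turns \<open>Z\<close> into a polynomial expression in
  \<open>f\<^sub>a(t) = (\<Sum>l\<ge>1. l ^ a * exp (l * t))\<close>, evaluated at \<open>\<epsilon>\<close> times partial sums of the \<open>r\<^sub>i\<close>, so the
  only poles that can meet the limit come from an initial run of letters with \<open>s\<^sub>i = 0\<close>.
  Symmetrization over the zero blocks is compatible with deconcatenation, and after it the sum
  over the orderings of the initial zero letters is an exponential of set functions with the
  entries \<open>\<plusminus>(card B - 1)! * f\<^sub>0(\<epsilon> * r\<^sub>B)\<close>, as \<open>f\<^sub>0\<close> satisfies the quasi-shuffle relation. Its singular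
  part \<open>- 1 / (\<epsilon> * r\<^sub>B)\<close> is cancelled, up to divided differences, by left convolution with a factor
  whose values on nonempty words are polar in \<open>\<epsilon>\<close>. By uniqueness of the Birkhoff
  decomposition, such a factor does not change \<open>Zplus\<close>, which therefore is a polynomial in
  symmetrized series that converge coefficientwise, and their polar parts.\<close>

section \<open>Laurent expansions of the nested sums\<close>

text \<open>Why symmetrize: for \<open>s = [0, 0]\<close> the regularized value is 1/3 + r1 / (12
  (r1 + r2)), which has no limit at 0, while its two orderings add up to 3/4. Even after
  symmetrization the two factors diverge: a single letter with exponent 0 contributes -1 /
  (\<epsilon> r) to \<open>Zbar\<close> and 1 / (\<epsilon> r) to \<open>Zminus\<close>, and only
  their product can converge. Hence a factor and its inverse are inserted between them, so that both
  new factors have convergent symmetrizations. The shape of that factor comes from the exponential: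
  exponentials of set functions multiply by adding their entries, and f_0(\<epsilon> r_B) + 1 /
  (\<epsilon> r_B) is regular. This is not exact, because letters given to the canceller no longer
  shift the argument G of the rest of the word. What remains is (G(y + t) - G(y)) / (\<epsilon> t)
  with t = r_B tending to 0. It arises once per block, so plain convergence of G is too weak a
  hypothesis for the induction; a class of functions of y closed under such quotients is carried
  instead. Negative powers of y are harmless there, since the rest begins with a letter whose
  argument has a positive limit.\<close>

lemma has_sum_times_complex:
  fixes f :: "'a \<Rightarrow> complex" and g :: "'b \<Rightarrow> complex"
  assumes f: "(f has_sum a) A" and g: "(g has_sum b) B"
  shows "((\<lambda>(x, y). f x * g y) has_sum a * b) (A \<times> B)"
proof (rule has_sum_SigmaI)
  have fa: "(\<lambda>x. norm (f x)) summable_on A" and gb: "(\<lambda>x. norm (g x)) summable_on B"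
    using f g by (auto dest!: has_sum_imp_summable simp flip: summable_on_iff_abs_summable_on_complex)
  show "((\<lambda>y. case (x, y) of (x, y) \<Rightarrow> f x * g y) has_sum f x * b) B" for x
    using has_sum_cmult_right[OF g] by simp
  show "((\<lambda>x. f x * b) has_sum a * b) A"
    by (rule has_sum_cmult_left[OF f])
  have "(\<lambda>z. norm (case z of (x, y) \<Rightarrow> f x * g y)) summable_on (A \<times> B)"
    using fa gb by (subst Infinite_Sum.abs_summable_on_Sigma_iff)
      (auto simp: norm_mult infsum_cmult_right' abs_mult intro!: summable_on_cmult_right summable_on_cmult_left)
  then show "(\<lambda>(x, y). f x * g y) summable_on A \<times> B"
    by (rule abs_summable_summable)
qed

lemma has_sum_sum_finite:
  fixes f :: "'a \<Rightarrow> 'b \<Rightarrow> complex"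
  assumes "finite I" "\<And>i. i \<in> I \<Longrightarrow> (f i has_sum s i) A"
  shows "((\<lambda>x. \<Sum>i\<in>I. f i x) has_sum (\<Sum>i\<in>I. s i)) A"
  using assms by (induction I rule: finite_induct) (auto intro: has_sum_add)

text \<open>The value of \<open>\<Sum>n\<ge>1. n ^ a * exp (n * t)\<close> for \<open>Re t < 0\<close>; the recursion comes from shifting
  the summation index by one.\<close>

fun eulerian :: "nat \<Rightarrow> complex \<Rightarrow> complex" where
  "eulerian a t = exp t / (1 - exp t) * (1 + (\<Sum>j<a. of_nat (a choose j) * eulerian j t))"

fun eulerian_fls :: "nat \<Rightarrow> complex fls" where
  "eulerian_fls a = fps_to_fls (fps_exp 1) / (1 - fps_to_fls (fps_exp 1)) *
     (1 + (\<Sum>j<a. fls_const (of_nat (a choose j)) * eulerian_fls j))"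

declare eulerian.simps [simp del] eulerian_fls.simps [simp del]

lemma summable_power_times_geometric:
  fixes x :: complex
  assumes "norm x < 1"
  shows "summable (\<lambda>n. norm (of_nat n ^ a * x ^ n))"
proof (cases "x = 0")
  case True
  then show ?thesis by (intro summable_finite[of "{0}"]) auto
next
  case False
  have "(\<lambda>n. real n ^ a * norm x ^ n) \<in> O(\<lambda>n. 1 / real n ^ 2)"
    using assms False by real_asymp
  moreover have "summable (\<lambda>n. norm (1 / real n ^ 2))"
    using inverse_power_summable[of 2, where ?'a = real] by (simp add: field_simps)
  ultimately have "summable (\<lambda>n. real n ^ a * norm x ^ n)"
    by (rule summable_comparison_test_bigo[rotated])
  then show ?thesis by (simp add: norm_mult norm_power)
qed

lemma has_sum_eulerian:
  assumes t: "Re t < 0"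
  shows "((\<lambda>n. of_nat n ^ a * exp (of_nat n * t)) has_sum eulerian a t) {1..}"
proof (induction a rule: less_induct)
  case (less a)
  define x where "x = exp t"
  have nx: "norm x < 1" using t by (simp add: x_def)
  have ex: "exp (of_nat n * t) = x ^ n" for n
    by (simp add: x_def exp_of_nat_mult)
  have "(\<lambda>n. of_nat n ^ a * x ^ n) summable_on UNIV"
    using summable_power_times_geometric[OF nx] by (rule norm_summable_imp_summable_on)
  then have "(\<lambda>n. of_nat n ^ a * x ^ n) summable_on {1..}"
    by (rule summable_on_subset_banach) simp
  then obtain S where S: "((\<lambda>n. of_nat n ^ a * x ^ n) has_sum S) {1..}"
    by (auto simp: summable_on_def)
  \<comment> \<open>The term \<open>j = a\<close> contains the unknown sum \<open>S\<close> itself,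
    so the index shift yields a linear equation for \<open>S\<close> with coefficient
    \<open>1 - x\<close>.\<close>
  have "((\<lambda>n. \<Sum>j\<le>a. of_nat (a choose j) * (of_nat n ^ j * x ^ n)) has_sum
      (\<Sum>j\<le>a. of_nat (a choose j) * (if j = a then S else eulerian j t))) {1..}"
    by (intro has_sum_sum_finite has_sum_cmult_right) (use S less.IH ex in auto)
  moreover have "(\<Sum>j\<le>a. of_nat (a choose j) * (of_nat n ^ j * x ^ n)) = (of_nat n + 1) ^ a * x ^ n" for n
    by (simp add: binomial_ring sum_distrib_right mult.assoc)
  moreover have "(\<Sum>j\<le>a. of_nat (a choose j) * (if j = a then S else eulerian j t))
      = (\<Sum>j<a. of_nat (a choose j) * eulerian j t) + S"
    by (simp add: lessThan_Suc_atMost[symmetric])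
  ultimately have "((\<lambda>n. (of_nat n + 1) ^ a * x ^ n) has_sum (\<Sum>j<a. of_nat (a choose j) * eulerian j t) + S) {1..}"
    by simp
  then have "((\<lambda>n. x * ((of_nat n + 1) ^ a * x ^ n)) has_sum x * ((\<Sum>j<a. of_nat (a choose j) * eulerian j t) + S)) {1..}"
    by (rule has_sum_cmult_right)
  also have "?this \<longleftrightarrow> ((\<lambda>n. of_nat n ^ a * x ^ n) has_sum x * ((\<Sum>j<a. of_nat (a choose j) * eulerian j t) + S)) {2..}"
    by (rule has_sum_reindex_bij_witness[of _ "\<lambda>n. n - 1" Suc]) (auto simp: power_Suc algebra_simps)
  finally have "((\<lambda>n. of_nat n ^ a * x ^ n) has_sum
      (of_nat 1 ^ a * x ^ 1 + x * ((\<Sum>j<a. of_nat (a choose j) * eulerian j t) + S))) (insert 1 {2..})"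
    by (intro has_sum_insert) auto
  also have "insert 1 {2..} = {1::nat..}" by auto
  finally have "S = x + x * ((\<Sum>j<a. of_nat (a choose j) * eulerian j t) + S)"
    using S has_sum_unique by fastforce
  then have "(1 - x) * S = x * (1 + (\<Sum>j<a. of_nat (a choose j) * eulerian j t))"
    by (simp add: algebra_simps)
  moreover have "1 - x \<noteq> 0" using nx by auto
  ultimately have "S = x / (1 - x) * (1 + (\<Sum>j<a. of_nat (a choose j) * eulerian j t))"
    by (simp add: field_simps)
  then have "S = eulerian a t" by (subst eulerian.simps) (simp add: x_def)
  then show ?case using S ex by simp
qed

lemma eulerian_has_laurent_expansion: "eulerian a has_laurent_expansion eulerian_fls a"
proof (induction a rule: less_induct)
  case (less a)
  have e: "exp has_laurent_expansion fps_to_fls (fps_exp (1::complex))"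
    by (rule has_laurent_expansion_fps) (rule fps_expansion_intros)
  have "(\<lambda>t. exp t / (1 - exp t) * (1 + (\<Sum>j<a. of_nat (a choose j) * eulerian j t)))
     has_laurent_expansion eulerian_fls a"
    by (subst eulerian_fls.simps, intro laurent_expansion_intros e less.IH) auto
  then show ?case by (subst eulerian.simps[abs_def])
qed

definition scaled_eulerian :: "nat \<Rightarrow> real \<Rightarrow> complex fls" where
  "scaled_eulerian a r = fls_compose_fps (eulerian_fls a) (fps_const (of_real r) * fps_X)"

text \<open>Rescaling multiplies each coefficient by one power of \<open>r\<close>, so only
  coefficients of the polar part can blow up as \<open>r\<close> tends to 0.\<close>

lemma scaled_eulerian_nth:
  "r \<noteq> 0 \<Longrightarrow> fls_nth (scaled_eulerian a r) n = fls_nth (eulerian_fls a) n * of_real r powi n"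
  by (simp add: scaled_eulerian_def fls_nth_fls_compose_fps_linear)

lemma scaled_eulerian_has_laurent_expansion:
  assumes "r \<noteq> 0"
  shows "(\<lambda>\<epsilon>. eulerian a (of_real r * \<epsilon>)) has_laurent_expansion scaled_eulerian a r"
proof -
  have "((\<lambda>\<epsilon>. of_real r * \<epsilon>) :: complex \<Rightarrow> complex) has_laurent_expansion
      fps_to_fls (fps_const (of_real r) * fps_X)"
    by (intro has_laurent_expansion_fps fps_expansion_intros)
  from has_laurent_expansion_compose[OF eulerian_has_laurent_expansion this] assms
  show ?thesis by (simp add: scaled_eulerian_def o_def)
qed

text \<open>Writing \<open>n\<^sub>1 = l + n\<^sub>2\<close> with \<open>l > 0\<close> and expanding \<open>n\<^sub>1 ^ m\<^sub>1\<close> decouples the outermost summation.\<close>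

fun merge_sum :: "(nat \<Rightarrow> real \<Rightarrow> 'b::comm_semiring_1) \<Rightarrow> (nat \<times> real) list \<Rightarrow> 'b" where
  "merge_sum F [] = 1"
| "merge_sum F [(m, r)] = F m r"
| "merge_sum F ((m1, r1) # (m2, r2) # w) =
     (\<Sum>a\<le>m1. of_nat (m1 choose a) * F a r1 * merge_sum F ((m2 + (m1 - a), r1 + r2) # w))"

lemma merge_sum_has_laurent_expansion:
  assumes "\<forall>(m, r)\<in>set w. 0 < r"
  shows "(\<lambda>\<epsilon>. merge_sum (\<lambda>a r. eulerian a (of_real r * \<epsilon>)) w) has_laurent_expansion
           merge_sum scaled_eulerian w"
  using assms
proof (induction "scaled_eulerian" w rule: merge_sum.induct)
  case (2 m r)
  then show ?case using scaled_eulerian_has_laurent_expansion[of r] by simp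
next
  case (3 m1 r1 m2 r2 w)
  have "(\<lambda>\<epsilon>. of_nat (m1 choose a)) has_laurent_expansion of_nat (m1 choose a)" for a
    unfolding fls_of_nat by (rule has_laurent_expansion_const)
  with 3 show ?case
    by (auto intro!: laurent_expansion_intros scaled_eulerian_has_laurent_expansion)
qed auto

section \<open>Summation over decreasing tuples\<close>

fun summand :: "complex \<Rightarrow> (nat \<times> real) list \<Rightarrow> nat list \<Rightarrow> complex" where
  "summand \<epsilon> ((m, r) # w) (n # ns) = of_nat n ^ m * exp (of_nat n * (of_real r * \<epsilon>)) * summand \<epsilon> w ns"
| "summand \<epsilon> w ns = 1"

lemma summand_eq:
  assumes "length ns = length w"
  shows "summand \<epsilon> w ns = exp (\<epsilon> * (\<Sum>i<length w. of_nat (ns ! i) * of_real (snd (w ! i))))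
      * (\<Prod>i<length w. (of_nat (ns ! i)) ^ fst (w ! i))"
  using assms
proof (induction \<epsilon> w ns rule: summand.induct)
  case (1 \<epsilon> m r w n ns)
  let ?S = "\<Sum>i<length w. of_nat (ns ! i) * complex_of_real (snd (w ! i))"
  have "\<epsilon> * (of_nat n * of_real r + ?S) = of_nat n * (of_real r * \<epsilon>) + \<epsilon> * ?S"
    by (simp add: algebra_simps)
  with 1 show ?case
    by (simp add: sum.lessThan_Suc_shift prod.lessThan_Suc_shift exp_add
        del: sum.lessThan_Suc prod.lessThan_Suc)
qed auto

text \<open>The exponential splits along with the power: the part of it that depends on
  \<open>n\<close> joins the second letter, whose argument becomes \<open>r1 + r2\<close>. This is
  where the partial sums of the arguments come from.\<close>

lemma summand_merge:
  "summand \<epsilon> ((m1, r1) # (m2, r2) # w) ((l + n) # n # ns) =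
    (\<Sum>a\<le>m1. of_nat (m1 choose a) * (of_nat l ^ a * exp (of_nat l * (of_real r1 * \<epsilon>)) *
       summand \<epsilon> ((m2 + (m1 - a), r1 + r2) # w) (n # ns)))"
proof -
  have "of_nat (l + n) ^ m1 = (\<Sum>a\<le>m1. of_nat (m1 choose a) * of_nat l ^ a * (of_nat n :: complex) ^ (m1 - a))"
    by (simp add: binomial_ring)
  then show ?thesis
    by (simp add: sum_distrib_right sum_distrib_left exp_add ring_distribs power_add mult_ac
        del: Nat.add_diff_assoc add_diff_assoc2)
qed

lemma has_sum_summand:
  assumes "\<forall>(m, r)\<in>set w. 0 < r" and "Re \<epsilon> < 0"
  shows "(summand \<epsilon> w has_sum merge_sum (\<lambda>a r. eulerian a (of_real r * \<epsilon>)) w) (dec_tuples (length w))"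
  using assms
proof (induction "\<lambda>a r. eulerian a (of_real r * \<epsilon>)" w rule: merge_sum.induct)
  case 1
  have "dec_tuples 0 = {[]}" by (auto simp: dec_tuples_def)
  then show ?case by (simp add: has_sum_finiteI)
next
  case (2 m r)
  then have "Re (of_real r * \<epsilon>) < 0" by (simp add: mult_pos_neg)
  from has_sum_eulerian[OF this, of m]
  have "((\<lambda>n. summand \<epsilon> [(m, r)] [n]) has_sum eulerian m (of_real r * \<epsilon>)) {1..}"
    by simp
  also have "?this \<longleftrightarrow> (summand \<epsilon> [(m, r)] has_sum eulerian m (of_real r * \<epsilon>)) (dec_tuples 1)"
    by (rule has_sum_reindex_bij_witness[of _ hd "\<lambda>n. [n]"]) (auto simp: dec_tuples_def length_Suc_conv)
  finally show ?case by simp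
next
  case (3 m1 r1 m2 r2 w)
  let ?F = "\<lambda>a r. eulerian a (of_real r * \<epsilon>)"
  let ?D = "dec_tuples (Suc (length w))"
  have r1: "Re (of_real r1 * \<epsilon>) < 0" using 3 by (simp add: mult_pos_neg)
  have "(summand \<epsilon> ((m2 + (m1 - a), r1 + r2) # w) has_sum merge_sum ?F ((m2 + (m1 - a), r1 + r2) # w)) ?D"
    if "a \<le> m1" for a
    using 3 that by simp
  from has_sum_times_complex[OF has_sum_eulerian[OF r1] this]
  have "((\<lambda>p. \<Sum>a\<le>m1. of_nat (m1 choose a) * (case p of (l, ns) \<Rightarrow> of_nat l ^ a * exp (of_nat l * (of_real r1 * \<epsilon>)) *
       summand \<epsilon> ((m2 + (m1 - a), r1 + r2) # w) ns)) has_sum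
     (\<Sum>a\<le>m1. of_nat (m1 choose a) * (?F a r1 * merge_sum ?F ((m2 + (m1 - a), r1 + r2) # w)))) ({1..} \<times> ?D)"
    by (intro has_sum_sum_finite has_sum_cmult_right) auto
  also have "?this \<longleftrightarrow> (summand \<epsilon> ((m1, r1) # (m2, r2) # w) has_sum merge_sum ?F ((m1, r1) # (m2, r2) # w))
     (dec_tuples (Suc (Suc (length w))))"
  proof (rule has_sum_reindex_bij_witness[of _ "\<lambda>ns. (hd ns - hd (tl ns), tl ns)" "\<lambda>(l, ns). (l + hd ns) # ns"], goal_cases)
    case (5 p)
    obtain l ns where p: "p = (l, ns)" by (cases p)
    with 5 obtain n ns' where ns: "ns = n # ns'"
      by (auto simp: dec_tuples_def length_Suc_conv)
    show ?case unfolding p ns by (simp only: prod.case list.sel summand_merge)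
  next
    case 6
    show ?case by (simp add: mult.assoc)
  qed (auto simp: dec_tuples_def length_Suc_conv intro!: trans_less_add2)
  finally show ?case by simp
qed

text \<open>Agreement is known only on a half disc. Convergence at one point of it gives a positive
  radius, so the difference of two expansions is a Laurent series on a punctured disc; were it
  nonzero, it would not vanish near 0, contrary to its values on the negative real axis.\<close>

lemma laurent_expansion_of_unique:
  assumes F: "laurent_expansion_of F f" and G: "laurent_expansion_of G f"
  shows "F = G"
proof -
  have main: "\<exists>\<rho>>0. fls_conv_radius F > 0 \<and> (\<forall>\<epsilon>. 0 < norm \<epsilon> \<and> norm \<epsilon> < \<rho> \<and> Re \<epsilon> < 0 \<longrightarrow> eval_fls F \<epsilon> = f \<epsilon>)"
    if "laurent_expansion_of F f" for F
  proof -
    let ?n = "fls_subdegree F"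
    from that obtain \<rho> where \<rho>: "\<rho> > 0" "\<And>\<epsilon>. 0 < norm \<epsilon> \<and> norm \<epsilon> < \<rho> \<and> Re \<epsilon> < 0 \<Longrightarrow>
      (\<lambda>n. fls_nth F (int n + ?n) * \<epsilon> powi (int n + ?n)) sums f \<epsilon>"
      unfolding laurent_expansion_of_def by blast
    define z where "z = complex_of_real (- \<rho> / 2)"
    have z: "0 < norm z \<and> norm z < \<rho> \<and> Re z < 0" using \<rho>(1) by (auto simp: z_def)
    from \<rho>(2)[OF z] have "summable (\<lambda>n. fls_nth F (int n + ?n) * z powi (int n + ?n))"
      by (simp add: sums_iff)
    then have "summable (\<lambda>n. fls_nth F (int n + ?n) * z powi (int n + ?n) * z powi (- ?n))"
      by (rule summable_mult2)
    moreover have "z powi (int n + ?n) * z powi (- ?n) = z ^ n" for n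
      using z by (subst power_int_add[symmetric]) auto
    ultimately have "summable (\<lambda>n. fls_nth F (int n + ?n) * z ^ n)"
      by (simp only: mult.assoc)
    then have "ereal (norm z) \<le> conv_radius (\<lambda>n. fls_nth F (int n + ?n))"
      by (rule conv_radius_geI)
    then have rad: "ereal (norm z) \<le> fls_conv_radius F"
      by (simp add: fls_conv_radius_altdef fps_conv_radius_def)
    have "eval_fls F \<epsilon> = f \<epsilon>" if "0 < norm \<epsilon> \<and> norm \<epsilon> < norm z \<and> Re \<epsilon> < 0" for \<epsilon>
    proof -
      have "ereal (norm \<epsilon>) < fls_conv_radius F" using that rad by (meson less_ereal.simps(1) less_le_trans)
      from sums_eval_fls[OF this] \<rho>(2)[of \<epsilon>] that z show ?thesis
        by (auto intro: sums_unique2)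
    qed
    moreover have "fls_conv_radius F > 0" using rad z
      by (metis ereal_less(2) less_le_trans)
    ultimately show ?thesis using z by blast
  qed
  from main[OF F] obtain \<rho> where \<rho>: "\<rho> > 0" "fls_conv_radius F > 0"
    "\<And>\<epsilon>. 0 < norm \<epsilon> \<and> norm \<epsilon> < \<rho> \<and> Re \<epsilon> < 0 \<Longrightarrow> eval_fls F \<epsilon> = f \<epsilon>" by blast
  from main[OF G] obtain \<rho>' where \<rho>': "\<rho>' > 0" "fls_conv_radius G > 0"
    "\<And>\<epsilon>. 0 < norm \<epsilon> \<and> norm \<epsilon> < \<rho>' \<and> Re \<epsilon> < 0 \<Longrightarrow> eval_fls G \<epsilon> = f \<epsilon>" by blast
  have H: "(\<lambda>\<epsilon>. eval_fls F \<epsilon> - eval_fls G \<epsilon>) has_laurent_expansion F - G"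
    using \<rho> \<rho>' by (intro laurent_expansion_intros)
  show ?thesis
  proof (rule ccontr)
    assume "F \<noteq> G"
    then have "eventually (\<lambda>\<epsilon>. eval_fls F \<epsilon> - eval_fls G \<epsilon> \<noteq> 0) (at 0)"
      using has_laurent_expansion_nonzero_imp_eventually_nonzero[OF H] by simp
    then obtain d where d: "d > 0" "\<And>\<epsilon>. \<epsilon> \<noteq> 0 \<Longrightarrow> norm \<epsilon> < d \<Longrightarrow> eval_fls F \<epsilon> - eval_fls G \<epsilon> \<noteq> 0"
      by (auto simp: eventually_at dist_norm)
    define m where "m = min d (min \<rho> \<rho>')"
    have m: "m > 0" "m \<le> d" "m \<le> \<rho>" "m \<le> \<rho>'"
      using d(1) \<rho>(1) \<rho>'(1) by (auto simp: m_def)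
    define \<epsilon> where "\<epsilon> = complex_of_real (- m / 2)"
    have n: "norm \<epsilon> = m / 2" "0 < norm \<epsilon>" "Re \<epsilon> < 0" "\<epsilon> \<noteq> 0"
      using m(1) by (auto simp: \<epsilon>_def)
    have "eval_fls F \<epsilon> = f \<epsilon>" "eval_fls G \<epsilon> = f \<epsilon>"
      using n(2,3) m by (auto simp: n(1) intro!: \<rho>(3) \<rho>'(3))
    then show False using d(2)[of \<epsilon>] n m by simp
  qed
qed

text \<open>Evaluates the definite description in \<open>Zbar\<close>: the closed form of the nested
  sum has a Laurent expansion at 0, and \<open>laurent_expansion_of_unique\<close> excludes any
  other series.\<close>

lemma Zbar_eq_merge_sum:
  assumes "\<forall>(s, r)\<in>set w. s \<le> 0 \<and> 0 < r"
  shows "Zbar w = merge_sum scaled_eulerian (map (map_prod (\<lambda>s. nat (- s)) id) w)"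
proof -
  define v where "v = map (map_prod (\<lambda>s. nat (- s)) id) w"
  have v: "\<forall>(m, r)\<in>set v. 0 < r"
    using assms by (auto simp: v_def)
  have Z: "Zfun w \<epsilon> = merge_sum (\<lambda>a r. eulerian a (of_real r * \<epsilon>)) v" if "Re \<epsilon> < 0" for \<epsilon>
  proof -
    have len: "length w = length v" by (simp add: v_def)
    have "Zfun w \<epsilon> = (\<Sum>\<^sub>\<infinity>ns\<in>dec_tuples (length v). summand \<epsilon> v ns)"
      unfolding Zfun_def len
    proof (rule infsum_cong)
      fix ns assume "ns \<in> dec_tuples (length v)"
      then have ns: "length ns = length v" by (simp add: dec_tuples_def)
      have "(\<Prod>i<length v. (of_nat (ns ! i) :: complex) powi (- fst (w ! i))) =
         (\<Prod>i<length v. of_nat (ns ! i) ^ fst (v ! i))"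
      proof (rule prod.cong)
        fix i assume "i \<in> {..<length v}"
        then have "i < length w" by (simp add: v_def)
        then have "fst (w ! i) \<le> 0" using assms nth_mem[of i w] by (auto simp: case_prod_beta)
        then show "(of_nat (ns ! i) :: complex) powi (- fst (w ! i)) = of_nat (ns ! i) ^ fst (v ! i)"
          using \<open>i < length w\<close> by (simp add: v_def power_int_def)
      qed (simp add: v_def)
      moreover have "(\<Sum>i<length v. of_nat (ns ! i) * complex_of_real (snd (w ! i))) =
         (\<Sum>i<length v. of_nat (ns ! i) * of_real (snd (v ! i)))"
        by (simp add: v_def)
      ultimately show "exp (\<epsilon> * (\<Sum>i<length v. of_nat (ns ! i) * of_real (snd (w ! i))))
      * (\<Prod>i<length v. (of_nat (ns ! i) :: complex) powi (- fst (w ! i))) = summand \<epsilon> v ns"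
        by (simp only: summand_eq[OF ns])
    qed
    also have "\<dots> = merge_sum (\<lambda>a r. eulerian a (of_real r * \<epsilon>)) v"
      using has_sum_summand[OF v that] by (rule infsumI)
    finally show ?thesis .
  qed
  let ?F = "merge_sum scaled_eulerian v"
  from merge_sum_has_laurent_expansion[OF v]
  have rad: "fls_conv_radius ?F > 0"
    and ev: "eventually (\<lambda>\<epsilon>. eval_fls ?F \<epsilon> = merge_sum (\<lambda>a r. eulerian a (of_real r * \<epsilon>)) v) (at 0)"
    by (auto simp: has_laurent_expansion_def)
  from ev obtain d where d: "d > 0" "\<And>\<epsilon>. \<epsilon> \<noteq> 0 \<Longrightarrow> norm \<epsilon> < d \<Longrightarrow>
      eval_fls ?F \<epsilon> = merge_sum (\<lambda>a r. eulerian a (of_real r * \<epsilon>)) v"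
    by (auto simp: eventually_at dist_norm)
  from rad obtain \<rho> where \<rho>: "\<rho> > 0" "ereal \<rho> < fls_conv_radius ?F"
    using ereal_dense2[of 0 "fls_conv_radius ?F"] by (auto simp: zero_ereal_def)
  have "laurent_expansion_of ?F (Zfun w)"
    unfolding laurent_expansion_of_def
  proof (intro exI[of _ "min d \<rho>"] conjI allI impI)
    fix \<epsilon> :: complex assume \<epsilon>: "0 < norm \<epsilon> \<and> norm \<epsilon> < min d \<rho> \<and> Re \<epsilon> < 0"
    then have "ereal (norm \<epsilon>) < ereal \<rho>" by simp
    also note \<rho>(2)
    finally have "(\<lambda>n. fls_nth ?F (int n + fls_subdegree ?F) * \<epsilon> powi (int n + fls_subdegree ?F)) sums eval_fls ?F \<epsilon>"
      by (rule sums_eval_fls) (use \<epsilon> in auto)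
    then show "(\<lambda>n. fls_nth ?F (int n + fls_subdegree ?F) * \<epsilon> powi (int n + fls_subdegree ?F)) sums Zfun w \<epsilon>"
      using d(2)[of \<epsilon>] Z[of \<epsilon>] \<epsilon> by auto
  qed (use d \<rho> in auto)
  then show ?thesis
    unfolding Zbar_def v_def[symmetric]
    by (intro the_equality) (auto dest: laurent_expansion_of_unique)
qed

section \<open>Laurent series converging along a filter\<close>

notation fls_nth (infixl \<open>$$\<close> 75)

text \<open>The simple pole of exp t / (1 - exp t) at 0, with residue -1, found by comparing
  subdegrees and lowest coefficients in \<open>eulerian_fls 0 * (1 - E) = E\<close>.\<close>

lemma eulerian_fls_0_nth:
  "n < -1 \<Longrightarrow> eulerian_fls 0 $$ n = 0" "eulerian_fls 0 $$ (-1) = -1"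
proof -
  define E where "E = fps_to_fls (fps_exp (1::complex))"
  have eq: "eulerian_fls 0 = E / (1 - E)" by (subst eulerian_fls.simps) (simp add: E_def)
  have nth: "E $$ n = (if n < 0 then 0 else 1 / fact (nat n))" for n by (simp add: E_def)
  have sub: "fls_subdegree (1 - E) = 1"
    by (rule fls_subdegree_eqI) (auto simp: nth)
  have "1 - E \<noteq> 0" using sub by auto
  then have mult: "eulerian_fls 0 * (1 - E) = E" by (simp add: eq)
  have E0: "fls_subdegree E = 0"
    by (rule fls_subdegree_eqI) (auto simp: nth)
  then have "E \<noteq> 0" using nth[of 0] by auto
  with mult \<open>1 - E \<noteq> 0\<close> have "fls_subdegree (eulerian_fls 0) + 1 = 0"
    by (metis E0 sub fls_subdegree_mult mult_zero_left)
  then have s: "fls_subdegree (eulerian_fls 0) = -1" by simp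
  then show "n < -1 \<Longrightarrow> eulerian_fls 0 $$ n = 0" by simp
  have "(eulerian_fls 0 * (1 - E)) $$ 0 = eulerian_fls 0 $$ (-1) * (1 - E) $$ 1"
    using s sub by (simp add: fls_times_nth(2))
  with mult have "- (eulerian_fls 0 $$ (-1)) = 1" by (simp add: nth)
  then show "eulerian_fls 0 $$ (-1) = -1" by (metis minus_minus)
qed

text \<open>Bounds \<open>N\<close> and \<open>M\<close> that are uniform in a parameter give a
  range of summation that does not move with it, unlike the subdegrees in
  \<open>fls_times_nth\<close>.\<close>

lemma fls_times_nth_bounds:
  fixes f g :: "'a::semiring_0 fls"
  assumes "\<And>n. n < N \<Longrightarrow> f $$ n = 0" "\<And>n. n < M \<Longrightarrow> g $$ n = 0"
  shows "(f * g) $$ n = (\<Sum>i=N..n - M. f $$ i * g $$ (n - i))"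
proof (cases "f = 0 \<or> g = 0")
  case True
  then show ?thesis by auto
next
  case False
  then have "N \<le> fls_subdegree f" "M \<le> fls_subdegree g"
    using assms by (auto intro!: fls_subdegree_geI)
  then show ?thesis
    unfolding fls_times_nth(2)
    by (intro sum.mono_neutral_left) auto
qed

section \<open>Polar series and the projection onto them\<close>

definition polar :: "complex fls \<Rightarrow> bool" where
  "polar f \<longleftrightarrow> (\<forall>n\<ge>0. f $$ n = 0)"

lemma polar_0 [intro]: "polar 0"
  and polar_add: "polar f \<Longrightarrow> polar g \<Longrightarrow> polar (f + g)"
  and polar_diff: "polar f \<Longrightarrow> polar g \<Longrightarrow> polar (f - g)"
  and polar_const_mult: "polar f \<Longrightarrow> polar (fls_const c * f)"
  and polar_uminus_Ppart: "polar (- Ppart f)"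
  by (auto simp: polar_def fls_prpart_as_fls_nth simp del: fls_shift_nth)

lemma polar_sum: "(\<And>i. i \<in> I \<Longrightarrow> polar (f i)) \<Longrightarrow> polar (sum f I)"
  by (induction I rule: infinite_finite_induct) (auto intro: polar_add)

lemma polar_mult: "polar f \<Longrightarrow> polar g \<Longrightarrow> polar (f * g)"
  unfolding polar_def fls_times_nth(2)
proof (intro allI impI sum.neutral ballI)
  fix n i :: int
  assume "\<forall>n\<ge>0. f $$ n = 0" "\<forall>n\<ge>0. g $$ n = 0" "0 \<le> n"
  then show "f $$ i * g $$ (n - i) = 0" by (cases "i \<ge> 0") auto
qed

lemma Ppart_polar: "polar f \<Longrightarrow> Ppart f = f"
  by (intro fls_eqI) (auto simp: polar_def fls_prpart_as_fls_nth simp del: fls_shift_nth)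

lemma Ppart_eq_0: "(\<And>n. n < 0 \<Longrightarrow> f $$ n = 0) \<Longrightarrow> Ppart f = 0"
  by (intro fls_eqI) (auto simp: fls_prpart_as_fls_nth simp del: fls_shift_nth)

lemma Ppart_diff: "Ppart (f - g) = Ppart f - Ppart g"
  by (intro fls_eqI) (simp only: fls_minus_nth fls_prpart_as_fls_nth, simp)

lemma Ppart_add: "Ppart (f + g) = Ppart f + Ppart g"
  by (intro fls_eqI) (simp only: fls_plus_nth fls_prpart_as_fls_nth, simp)

lemma Ppart_sum: "Ppart (sum f I) = (\<Sum>i\<in>I. Ppart (f i))"
  using sum_comp_morphism[of "\<lambda>f. Ppart f" f I, OF Ppart_polar[OF polar_0] Ppart_add]
  by (simp only: o_def)

text \<open>A class of functions of \<open>y \<ge> 0\<close> that is closed under divided differences whose step tends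
  to \<open>0\<close> along \<open>F\<close>.\<close>

inductive tame :: "'a filter \<Rightarrow> ('a \<Rightarrow> real \<Rightarrow> complex) \<Rightarrow> bool" for F where
  const: "(c \<longlongrightarrow> l) F \<Longrightarrow> tame F (\<lambda>p y. c p)"
| var: "tame F (\<lambda>p y. of_real y)"
| recip: "(q \<longlongrightarrow> l) F \<Longrightarrow> 0 < l \<Longrightarrow> (\<And>p. 0 < q p) \<Longrightarrow> tame F (\<lambda>p y. of_real (1 / (q p + y)))"
| add: "tame F g \<Longrightarrow> tame F h \<Longrightarrow> tame F (\<lambda>p y. g p y + h p y)"
| mult: "tame F g \<Longrightarrow> tame F h \<Longrightarrow> tame F (\<lambda>p y. g p y * h p y)"

lemma tame_sum: "(\<And>i. i \<in> I \<Longrightarrow> tame F (g i)) \<Longrightarrow> tame F (\<lambda>p y. \<Sum>i\<in>I. g i p y)"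
  by (induction I rule: infinite_finite_induct)
     (auto intro: tame.add tame.const[OF tendsto_const])

lemma tame_power: "tame F g \<Longrightarrow> tame F (\<lambda>p y. g p y ^ n)"
  by (induction n) (auto intro: tame.mult tame.const[OF tendsto_const])

lemma tame_tendsto: "tame F g \<Longrightarrow> \<exists>l. ((\<lambda>p. g p 0) \<longlongrightarrow> l) F"
proof (induction rule: tame.induct)
  case (recip q l)
  then have "((\<lambda>p. complex_of_real (1 / q p)) \<longlongrightarrow> of_real (1 / l)) F"
    by (intro tendsto_intros) auto
  then show ?case by auto
qed (auto intro: tendsto_add tendsto_mult)

text \<open>The shift is absorbed into the data: \<open>q p + t p\<close> has the same positive
  limit as \<open>q p\<close>.\<close>

lemma tame_shift:
  assumes "tame F g" and t: "(t \<longlongrightarrow> 0) F" "\<And>p. 0 < t p"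
  shows "tame F (\<lambda>p y. g p (y + t p))"
  using assms(1)
proof (induction rule: tame.induct)
  case var
  have "tame F (\<lambda>p y. of_real y + of_real (t p))"
    by (intro tame.add tame.var tame.const[OF tendsto_of_real[OF t(1)]])
  then show ?case by simp
next
  case (recip q l)
  have "tame F (\<lambda>p y. of_real (1 / ((q p + t p) + y)))"
  proof (rule tame.recip)
    show "((\<lambda>p. q p + t p) \<longlongrightarrow> l) F" using tendsto_add[OF recip(1) t(1)] by simp
  qed (use recip t in \<open>auto intro: add_pos_pos\<close>)
  then show ?case by (simp add: add_ac)
qed (auto intro: tame.intros)

text \<open>Products obey the Leibniz rule with one factor shifted, and the reciprocal has the
  difference - t / ((q + y) (q + y + t)). Restricting to \<open>y \<ge> 0\<close> keeps the
  denominators positive.\<close>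

lemma tame_divided_difference:
  assumes "tame F g" and t: "(t \<longlongrightarrow> 0) F" "\<And>p. 0 < t p"
  shows "\<exists>g'. tame F g' \<and> (\<forall>p. \<forall>y\<ge>0. g p (y + t p) - g p y = of_real (t p) * g' p y)"
  using assms(1)
proof (induction rule: tame.induct)
  case (const c l)
  show ?case by (rule exI[of _ "\<lambda>p y. 0"]) (auto intro: tame.const)
next
  case var
  show ?case by (rule exI[of _ "\<lambda>p y. 1"]) (auto intro: tame.const)
next
  case (recip q l)
  let ?g' = "\<lambda>p y. (-1) * (complex_of_real (1 / (q p + (y + t p))) * of_real (1 / (q p + y)))"
  have r: "tame F (\<lambda>p y. complex_of_real (1 / (q p + y)))"
    by (rule tame.recip) (use recip in auto)
  have "tame F ?g'"
    by (intro tame.mult tame.const[OF tendsto_const] r tame_shift[OF r t])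
  moreover have "complex_of_real (1 / (q p + (y + t p))) - of_real (1 / (q p + y)) = of_real (t p) * ?g' p y"
    if "y \<ge> 0" for p y
  proof -
    have "q p + y \<noteq> 0" "q p + (y + t p) \<noteq> 0"
      using that recip(3)[of p] t(2)[of p] by linarith+
    then have "1 / (q p + (y + t p)) - 1 / (q p + y) = t p * ((-1) * (1 / (q p + (y + t p)) * (1 / (q p + y))))"
      by (simp add: field_simps)
    then show ?thesis
      by (metis of_real_1 of_real_diff of_real_minus of_real_mult)
  qed
  ultimately show ?case by blast
next
  case (add g h)
  then obtain g' h' where *: "tame F g'" "tame F h'"
    and eq: "\<And>p y. y \<ge> 0 \<Longrightarrow> g p (y + t p) = g p y + of_real (t p) * g' p y"
       "\<And>p y. y \<ge> 0 \<Longrightarrow> h p (y + t p) = h p y + of_real (t p) * h' p y"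
    by (metis add.commute diff_add_cancel)
  show ?case
    by (rule exI[of _ "\<lambda>p y. g' p y + h' p y"]) (auto intro: tame.add * simp: eq algebra_simps)
next
  case (mult g h)
  then obtain g' h' where *: "tame F g'" "tame F h'"
    and eq: "\<And>p y. y \<ge> 0 \<Longrightarrow> g p (y + t p) - g p y = of_real (t p) * g' p y"
       "\<And>p y. y \<ge> 0 \<Longrightarrow> h p (y + t p) - h p y = of_real (t p) * h' p y"
    by blast
  have "g p (y + t p) * h p (y + t p) - g p y * h p y =
      of_real (t p) * (g' p y * h p (y + t p) + g p y * h' p y)" if "y \<ge> 0" for p y
  proof -
    have "g p (y + t p) * h p (y + t p) - g p y * h p y =
       (g p (y + t p) - g p y) * h p (y + t p) + g p y * (h p (y + t p) - h p y)"
      by (simp add: algebra_simps)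
    then show ?thesis by (simp add: eq that algebra_simps)
  qed
  moreover have "tame F (\<lambda>p y. g' p y * h p (y + t p) + g p y * h' p y)"
    by (intro tame.add tame.mult * mult(1,2) tame_shift[OF mult(2) t])
  ultimately show ?case by blast
qed

text \<open>The bound \<open>N\<close> is uniform over all \<open>p\<close>, not merely along
  \<open>F\<close>, so that each coefficient of a product is a fixed finite sum of products of
  coefficients.\<close>

definition convergent_fls :: "'a filter \<Rightarrow> ('a \<Rightarrow> complex fls) \<Rightarrow> bool" where
  "convergent_fls F \<Phi> \<longleftrightarrow> (\<exists>N. \<forall>p. \<forall>n<N. \<Phi> p $$ n = 0) \<and> (\<forall>n. \<exists>l. ((\<lambda>p. \<Phi> p $$ n) \<longlongrightarrow> l) F)"

text \<open>\<open>y\<close> stands for the total of the vanishing arguments in front of the rest of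
  a word, hence \<open>y \<ge> 0\<close>.\<close>

definition tame_fls :: "'a filter \<Rightarrow> ('a \<Rightarrow> real \<Rightarrow> complex fls) \<Rightarrow> bool" where
  "tame_fls F \<Phi> \<longleftrightarrow> (\<exists>N. \<forall>p. \<forall>y\<ge>0. \<forall>n<N. \<Phi> p y $$ n = 0) \<and>
     (\<forall>n. \<exists>g. tame F g \<and> (\<forall>p. \<forall>y\<ge>0. \<Phi> p y $$ n = g p y))"

lemma tame_flsE:
  assumes "tame_fls F \<Phi>"
  obtains N g where "\<And>p y n. y \<ge> 0 \<Longrightarrow> n < N \<Longrightarrow> \<Phi> p y $$ n = 0" "\<And>n. tame F (g n)"
    "\<And>p y n. y \<ge> 0 \<Longrightarrow> \<Phi> p y $$ n = g n p y"
  using assms unfolding tame_fls_def by metis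

lemma tame_fls_of_convergent: "convergent_fls F \<Phi> \<Longrightarrow> tame_fls F (\<lambda>p y. \<Phi> p)"
  unfolding convergent_fls_def tame_fls_def by (blast intro: tame.const)

lemma convergent_fls_at_0:
  assumes "tame_fls F \<Phi>"
  shows "convergent_fls F (\<lambda>p. \<Phi> p 0)"
  using assms
proof (rule tame_flsE)
  fix N g assume *: "\<And>p y n. y \<ge> 0 \<Longrightarrow> n < N \<Longrightarrow> \<Phi> p y $$ n = 0" "\<And>n. tame F (g n)"
    "\<And>p y n. y \<ge> 0 \<Longrightarrow> \<Phi> p y $$ n = g n p y"
  then show ?thesis
    unfolding convergent_fls_def using tame_tendsto[OF *(2)] by auto
qed

lemma tame_fls_mult:
  assumes "tame_fls F \<Phi>" "tame_fls F \<Psi>"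
  shows "tame_fls F (\<lambda>p y. \<Phi> p y * \<Psi> p y)"
proof -
  obtain N g where 1: "\<And>p y n. y \<ge> 0 \<Longrightarrow> n < N \<Longrightarrow> \<Phi> p y $$ n = 0" "\<And>n. tame F (g n)"
    "\<And>p y n. y \<ge> 0 \<Longrightarrow> \<Phi> p y $$ n = g n p y" using assms(1) by (rule tame_flsE) blast
  obtain M h where 2: "\<And>p y n. y \<ge> 0 \<Longrightarrow> n < M \<Longrightarrow> \<Psi> p y $$ n = 0" "\<And>n. tame F (h n)"
    "\<And>p y n. y \<ge> 0 \<Longrightarrow> \<Psi> p y $$ n = h n p y" using assms(2) by (rule tame_flsE) blast
  have eq: "(\<Phi> p y * \<Psi> p y) $$ n = (\<Sum>i=N..n - M. \<Phi> p y $$ i * \<Psi> p y $$ (n - i))" if "y \<ge> 0" for p y n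
    by (rule fls_times_nth_bounds) (use 1 2 that in auto)
  have "(\<Phi> p y * \<Psi> p y) $$ n = 0" if "y \<ge> 0" "n < N + M" for p y n
    unfolding eq[OF that(1)] using that by simp
  moreover have "(\<Phi> p y * \<Psi> p y) $$ n = (\<Sum>i=N..n - M. g i p y * h (n - i) p y)" if "y \<ge> 0" for p y n
    unfolding eq[OF that] using 1(3)[OF that] 2(3)[OF that] by simp
  moreover have "tame F (\<lambda>p y. \<Sum>i=N..n - M. g i p y * h (n - i) p y)" for n
    by (intro tame_sum tame.mult 1 2)
  ultimately show ?thesis unfolding tame_fls_def by blast
qed

lemma tame_fls_add:
  assumes "tame_fls F \<Phi>" "tame_fls F \<Psi>"
  shows "tame_fls F (\<lambda>p y. \<Phi> p y + \<Psi> p y)"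
proof -
  obtain N g where 1: "\<And>p y n. y \<ge> 0 \<Longrightarrow> n < N \<Longrightarrow> \<Phi> p y $$ n = 0" "\<And>n. tame F (g n)"
    "\<And>p y n. y \<ge> 0 \<Longrightarrow> \<Phi> p y $$ n = g n p y" using assms(1) by (rule tame_flsE) blast
  obtain M h where 2: "\<And>p y n. y \<ge> 0 \<Longrightarrow> n < M \<Longrightarrow> \<Psi> p y $$ n = 0" "\<And>n. tame F (h n)"
    "\<And>p y n. y \<ge> 0 \<Longrightarrow> \<Psi> p y $$ n = h n p y" using assms(2) by (rule tame_flsE) blast
  have "(\<Phi> p y + \<Psi> p y) $$ n = 0" if "y \<ge> 0" "n < min N M" for p y n
    using that 1 2 by simp
  moreover have "(\<Phi> p y + \<Psi> p y) $$ n = g n p y + h n p y" if "y \<ge> 0" for p y n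
    using 1(3)[OF that] 2(3)[OF that] by simp
  ultimately show ?thesis unfolding tame_fls_def using tame.add[OF 1(2) 2(2)] by blast
qed

lemma tame_fls_shift:
  assumes "tame_fls F \<Phi>" and t: "(t \<longlongrightarrow> 0) F" "\<And>p. 0 < t p"
  shows "tame_fls F (\<lambda>p y. \<Phi> p (y + t p))"
proof -
  obtain N g where 1: "\<And>p y n. y \<ge> 0 \<Longrightarrow> n < N \<Longrightarrow> \<Phi> p y $$ n = 0" "\<And>n. tame F (g n)"
    "\<And>p y n. y \<ge> 0 \<Longrightarrow> \<Phi> p y $$ n = g n p y" using assms(1) by (rule tame_flsE) blast
  have "y + t p \<ge> 0" if "y \<ge> 0" for p y using that t(2)[of p] by simp
  then show ?thesis unfolding tame_fls_def using tame_shift[OF 1(2) t] 1 by blast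
qed

lemma tame_fls_divided_difference:
  assumes "tame_fls F \<Phi>" and t: "(t \<longlongrightarrow> 0) F" "\<And>p. 0 < t p"
  shows "tame_fls F (\<lambda>p y. fls_const (of_real (1 / t p)) * (\<Phi> p (y + t p) - \<Phi> p y))"
proof -
  obtain N g where 1: "\<And>p y n. y \<ge> 0 \<Longrightarrow> n < N \<Longrightarrow> \<Phi> p y $$ n = 0" "\<And>n. tame F (g n)"
    "\<And>p y n. y \<ge> 0 \<Longrightarrow> \<Phi> p y $$ n = g n p y" using assms(1) by (rule tame_flsE) blast
  have pos: "y + t p \<ge> 0" if "y \<ge> 0" for p y using that t(2)[of p] by simp
  obtain g' where g': "\<And>n. tame F (g' n)"
    "\<And>n p y. y \<ge> 0 \<Longrightarrow> g n p (y + t p) - g n p y = of_real (t p) * g' n p y"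
    using tame_divided_difference[OF 1(2) t] by metis
  have "(fls_const (of_real (1 / t p)) * (\<Phi> p (y + t p) - \<Phi> p y)) $$ n = g' n p y" if "y \<ge> 0" for n p y
    using 1(3)[OF that] 1(3)[OF pos[OF that]] g'(2)[OF that] t(2)[of p] by simp
  moreover have "(fls_const (of_real (1 / t p)) * (\<Phi> p (y + t p) - \<Phi> p y)) $$ n = 0" if "y \<ge> 0" "n < N" for n p y
    using 1(1)[OF that] 1(1)[OF pos[OF that(1)] that(2)] by simp
  ultimately show ?thesis unfolding tame_fls_def using g'(1) by blast
qed

text \<open>The positive limit of \<open>q\<close> makes both signs of the exponent harmless:
  coefficients are multiples of powers of \<open>q p + y\<close> or of its reciprocal.\<close>

lemma tame_fls_scaled_eulerian:
  assumes q: "(q \<longlongrightarrow> l) F" "0 < l" "\<And>p. 0 < q p"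
  shows "tame_fls F (\<lambda>p y. scaled_eulerian a (q p + y))"
proof -
  have nz: "q p + y \<noteq> 0" if "y \<ge> 0" for p y using q(3)[of p] that by simp
  have "\<exists>g. tame F g \<and> (\<forall>p. \<forall>y\<ge>0. scaled_eulerian a (q p + y) $$ n = g p y)" for n
  proof (cases "n \<ge> 0")
    case True
    show ?thesis
    proof (intro exI conjI allI impI)
      show "tame F (\<lambda>p y. eulerian_fls a $$ n * (of_real (q p) + of_real y) ^ nat n)"
        by (intro tame.mult tame.const[OF tendsto_const] tame_power tame.add tame.var tame.const[OF tendsto_of_real[OF q(1)]])
    qed (use True nz in \<open>simp add: scaled_eulerian_nth power_int_def\<close>)
  next
    case False
    show ?thesis
    proof (intro exI conjI allI impI)
      show "tame F (\<lambda>p y. eulerian_fls a $$ n * of_real (1 / (q p + y)) ^ nat (-n))"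
        by (intro tame.mult tame.const[OF tendsto_const] tame_power tame.recip[OF q])
    qed (use False nz in \<open>simp add: scaled_eulerian_nth power_int_def field_simps\<close>)
  qed
  moreover have "scaled_eulerian a (q p + y) $$ n = 0" if "y \<ge> 0" "n < fls_subdegree (eulerian_fls a)" for p y n
    using that nz by (simp add: scaled_eulerian_nth)
  ultimately show ?thesis unfolding tame_fls_def by blast
qed

lemma convergent_fls_const: "convergent_fls F (\<lambda>p. c)"
  unfolding convergent_fls_def by (auto intro!: exI[of _ "fls_subdegree c"])

lemma convergent_fls_add:
  "convergent_fls F \<Phi> \<Longrightarrow> convergent_fls F \<Psi> \<Longrightarrow> convergent_fls F (\<lambda>p. \<Phi> p + \<Psi> p)"
  using convergent_fls_at_0[OF tame_fls_add[OF tame_fls_of_convergent tame_fls_of_convergent]] .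

lemma convergent_fls_mult:
  "convergent_fls F \<Phi> \<Longrightarrow> convergent_fls F \<Psi> \<Longrightarrow> convergent_fls F (\<lambda>p. \<Phi> p * \<Psi> p)"
  using convergent_fls_at_0[OF tame_fls_mult[OF tame_fls_of_convergent tame_fls_of_convergent]] .

lemma convergent_fls_sum:
  "(\<And>i. i \<in> I \<Longrightarrow> convergent_fls F (\<Phi> i)) \<Longrightarrow> convergent_fls F (\<lambda>p. \<Sum>i\<in>I. \<Phi> i p)"
  by (induction I rule: infinite_finite_induct) (auto intro: convergent_fls_add convergent_fls_const)

lemma tame_fls_sum:
  "(\<And>i. i \<in> I \<Longrightarrow> tame_fls F (\<Phi> i)) \<Longrightarrow> tame_fls F (\<lambda>p y. \<Sum>i\<in>I. \<Phi> i p y)"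
  by (induction I rule: infinite_finite_induct)
     (auto intro: tame_fls_add tame_fls_of_convergent convergent_fls_const)

lemma convergent_fls_Ppart:
  assumes "convergent_fls F \<Phi>"
  shows "convergent_fls F (\<lambda>p. - Ppart (\<Phi> p))"
proof -
  obtain N where N: "\<And>p n. n < N \<Longrightarrow> \<Phi> p $$ n = 0" and l: "\<And>n. \<exists>l. ((\<lambda>p. \<Phi> p $$ n) \<longlongrightarrow> l) F"
    using assms unfolding convergent_fls_def by blast
  have eq: "(- Ppart (\<Phi> p)) $$ n = (if n < 0 then - (\<Phi> p $$ n) else 0)" for p n
    by (simp add: fls_prpart_as_fls_nth del: fls_shift_nth)
  have "\<exists>l. ((\<lambda>p. (- Ppart (\<Phi> p)) $$ n) \<longlongrightarrow> l) F" for n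
    unfolding eq using l[of n] by (cases "n < 0") (auto intro: tendsto_minus)
  then show ?thesis unfolding convergent_fls_def eq using N by auto
qed

text \<open>For \<open>r \<noteq> 0\<close>, the polar part of \<open>scaled_eulerian 0 r\<close>
  with its sign reversed.\<close>

abbreviation simple_pole :: "real \<Rightarrow> complex fls" where
  "simple_pole r \<equiv> fls_X_inv * fls_const (of_real (1 / r))"

lemma simple_pole_nth: "simple_pole r $$ n = (if n = -1 then of_real (1 / r) else 0)"
  by simp

text \<open>With the pole gone, only multiples of \<open>t p ^ n\<close> with
  \<open>n \<ge> 0\<close> are left, and these converge although \<open>t\<close> tends to
  0.\<close>

lemma convergent_fls_regular:
  assumes t: "(t \<longlongrightarrow> 0) F" "\<And>p. 0 < t p"
  shows "convergent_fls F (\<lambda>p. scaled_eulerian 0 (t p) + simple_pole (t p))"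
proof -
  have eq: "(scaled_eulerian 0 (t p) + simple_pole (t p)) $$ n =
     (if n < 0 then 0 else eulerian_fls 0 $$ n * of_real (t p) ^ nat n)" for p n
  proof -
    consider "n < -1" | "n = -1" | "n \<ge> 0" by linarith
    then show ?thesis
    proof cases
      case 2
      then show ?thesis using t(2)[of p] unfolding fls_plus_nth simple_pole_nth
        by (simp add: scaled_eulerian_nth eulerian_fls_0_nth power_int_minus field_simps)
    qed (use t(2)[of p] in \<open>auto simp: scaled_eulerian_nth eulerian_fls_0_nth power_int_def simple_pole_nth\<close>)
  qed
  have "\<exists>l. ((\<lambda>p. if n < 0 then 0 else eulerian_fls 0 $$ n * complex_of_real (t p) ^ nat n) \<longlongrightarrow> l) F" for n
    by (cases "n < 0") (auto intro!: exI tendsto_mult[OF tendsto_const tendsto_power[OF tendsto_of_real[OF t(1)]]])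
  then show ?thesis
    unfolding convergent_fls_def eq by (auto intro!: exI[of _ 0])
qed

section \<open>Sums over orderings of the vanishing exponents\<close>

text \<open>Suffixes let the recursion on lists expose the value at the whole set first, as
  \<open>perm_sum_rec\<close> needs; the prefix sums produced by \<open>merge_sum\<close> are
  reached by reversing words.\<close>

fun suffix_prod :: "('b set \<Rightarrow> 'r::comm_ring_1) \<Rightarrow> 'b list \<Rightarrow> 'r" where
  "suffix_prod \<phi> [] = 1"
| "suffix_prod \<phi> (i # w) = \<phi> (insert i (set w)) * suffix_prod \<phi> w"

definition perm_sum :: "('b set \<Rightarrow> 'r::comm_ring_1) \<Rightarrow> 'b set \<Rightarrow> 'r" where
  "perm_sum \<phi> S = (\<Sum>w\<in>permutations_of_set S. suffix_prod \<phi> w)"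

text \<open>The coefficient of \<open>x ^ n / n!\<close> in \<open>ln (1 + x)\<close>.\<close>

definition log_coeff :: "nat \<Rightarrow> 'r::comm_ring_1" where
  "log_coeff n = (-1) ^ (n - 1) * of_nat (fact (n - 1))"

text \<open>Compares coefficients in (1 + x) L' = 1 for L = ln (1 + x). For \<open>n = 1\<close> the
  value \<open>log_coeff 0\<close> is multiplied by 0.\<close>

lemma log_coeff_rec:
  assumes "n > 0"
  shows "log_coeff n + of_nat (n - 1) * log_coeff (n - 1) = (if n = 1 then 1 else (0::'r::comm_ring_1))"
proof (cases "n = 1")
  case False
  then have "n = Suc (Suc (n - 2))" using assms by linarith
  then obtain k where "n = Suc (Suc k)" by blast
  then show ?thesis by (simp add: log_coeff_def algebra_simps)
qed (simp add: log_coeff_def)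

lemma perm_sum_empty [simp]: "perm_sum \<phi> {} = 1"
  by (simp add: perm_sum_def)

lemma perm_sum_rec:
  assumes "finite S" "S \<noteq> {}"
  shows "perm_sum \<phi> S = \<phi> S * (\<Sum>l\<in>S. perm_sum \<phi> (S - {l}))"
proof -
  have "perm_sum \<phi> S = (\<Sum>l\<in>S. \<Sum>w\<in>(#) l ` permutations_of_set (S - {l}). suffix_prod \<phi> w)"
    unfolding perm_sum_def permutations_of_set_nonempty[OF assms(2)]
    using assms by (intro sum.UNION_disjoint) auto
  also have "\<dots> = (\<Sum>l\<in>S. \<phi> S * perm_sum \<phi> (S - {l}))"
  proof (rule sum.cong)
    fix l assume "l \<in> S"
    have "(\<Sum>w\<in>(#) l ` permutations_of_set (S - {l}). suffix_prod \<phi> w) =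
        (\<Sum>w\<in>permutations_of_set (S - {l}). suffix_prod \<phi> (l # w))"
      by (subst sum.reindex) auto
    also have "\<dots> = (\<Sum>w\<in>permutations_of_set (S - {l}). \<phi> S * suffix_prod \<phi> w)"
      using \<open>l \<in> S\<close> by (intro sum.cong) (auto dest: permutations_of_setD simp: insert_absorb)
    finally show "(\<Sum>w\<in>(#) l ` permutations_of_set (S - {l}). suffix_prod \<phi> w) = \<phi> S * perm_sum \<phi> (S - {l})"
      by (simp add: perm_sum_def sum_distrib_left)
  qed simp
  finally show ?thesis by (simp add: sum_distrib_left)
qed

abbreviation subsets_with :: "'b \<Rightarrow> 'b set \<Rightarrow> 'b set set" where
  "subsets_with i S \<equiv> {B. B \<subseteq> S \<and> i \<in> B}"

text \<open>Pairs \<open>(B, l)\<close> are regrouped by \<open>C = insert l B\<close>, where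
  \<open>l\<close> can be any element of \<open>C\<close> except \<open>i\<close>. The coefficient
  of \<open>A (S - C)\<close> becomes the left side of \<open>log_coeff_rec\<close>, which vanishes
  unless \<open>C = {i}\<close>.\<close>

lemma sum_log_coeff_telescope:
  fixes A :: "'b set \<Rightarrow> 'r::comm_ring_1"
  assumes S: "finite S" "i \<in> S"
  shows "(\<Sum>B\<in>subsets_with i S. log_coeff (card B) * (A (S - B) + (\<Sum>l\<in>S - B. A (S - B - {l})))) = A (S - {i})"
proof -
  have fin: "finite (subsets_with i S)" using S by simp
  have finB: "finite B" if "B \<subseteq> S" for B using that S finite_subset by blast
  have "(\<Sum>B\<in>subsets_with i S. \<Sum>l\<in>S - B. log_coeff (card B) * A (S - B - {l})) =
    (\<Sum>(B, l)\<in>Sigma (subsets_with i S) (\<lambda>B. S - B). log_coeff (card B) * A (S - B - {l}))"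
    using fin S by (subst sum.Sigma) auto
  also have "\<dots> = (\<Sum>(C, l)\<in>Sigma (subsets_with i S) (\<lambda>C. C - {i}). log_coeff (card C - 1) * A (S - C))"
  proof (rule sum.reindex_bij_witness[of _ "\<lambda>(C, l). (C - {l}, l)" "\<lambda>(B, l). (insert l B, l)"], goal_cases)
    case (5 a)
    obtain B l where a: "a = (B, l)" by (cases a)
    with 5 have "B \<subseteq> S" "l \<notin> B" by auto
    then have "card (insert l B) - 1 = card B" "S - insert l B = S - B - {l}"
      using finB by auto
    then show ?case by (simp only: a prod.case)
  qed (use S in \<open>auto simp: insert_absorb\<close>)
  also have "\<dots> = (\<Sum>C\<in>subsets_with i S. \<Sum>l\<in>C - {i}. log_coeff (card C - 1) * A (S - C))"
    using fin finB by (subst sum.Sigma) auto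
  also have "\<dots> = (\<Sum>C\<in>subsets_with i S. of_nat (card C - 1) * log_coeff (card C - 1) * A (S - C))"
    by (rule sum.cong) (auto simp: finB card_Diff_singleton mult.assoc)
  finally have "(\<Sum>B\<in>subsets_with i S. log_coeff (card B) * (A (S - B) + (\<Sum>l\<in>S - B. A (S - B - {l})))) =
     (\<Sum>C\<in>subsets_with i S. (log_coeff (card C) + of_nat (card C - 1) * log_coeff (card C - 1)) * A (S - C))"
    by (simp add: sum.distrib ring_distribs sum_distrib_left)
  also have "\<dots> = (\<Sum>C\<in>subsets_with i S. if C = {i} then A (S - C) else 0)"
  proof (rule sum.cong)
    fix C assume C: "C \<in> subsets_with i S"
    then have "card C > 0" using finB card_gt_0_iff by blast
    moreover have "card C = 1 \<longleftrightarrow> C = {i}" using C by (auto simp: card_1_singleton_iff)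
    ultimately have "log_coeff (card C) + of_nat (card C - 1) * log_coeff (card C - 1) = (if C = {i} then 1 else (0::'r))"
      by (simp only: log_coeff_rec)
    then show "(log_coeff (card C) + of_nat (card C - 1) * log_coeff (card C - 1)) * A (S - C) =
        (if C = {i} then A (S - C) else 0)"
      by (simp only: if_distrib[of "\<lambda>u. u * A (S - C)"] mult_1_left mult_zero_left)
  qed simp
  also have "\<dots> = A (S - {i})"
    using S fin by (simp add: sum.delta')
  finally show ?thesis .
qed

lemma sum_subsets_swap:
  assumes S: "finite S" "i \<in> S"
  shows "(\<Sum>l\<in>S - {i}. \<Sum>B\<in>subsets_with i (S - {l}). f B l) = (\<Sum>B\<in>subsets_with i S. \<Sum>l\<in>S - B. f B l)"
proof -
  have "(\<Sum>l\<in>S - {i}. \<Sum>B\<in>subsets_with i (S - {l}). f B l) =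
     (\<Sum>(l, B)\<in>Sigma (S - {i}) (\<lambda>l. subsets_with i (S - {l})). f B l)"
    using S by (subst sum.Sigma) auto
  also have "\<dots> = (\<Sum>(B, l)\<in>Sigma (subsets_with i S) (\<lambda>B. S - B). f B l)"
    by (rule sum.reindex_bij_witness[of _ prod.swap prod.swap]) auto
  also have "\<dots> = (\<Sum>B\<in>subsets_with i S. \<Sum>l\<in>S - B. f B l)"
    using S by (subst sum.Sigma) auto
  finally show ?thesis .
qed

text \<open>In the quasi-shuffle algebra, the sum over all orderings of the letters in \<open>S\<close> is the exponential
  of the letter sums weighted by \<open>log_coeff\<close>; here the block containing \<open>i\<close> is split off.\<close>

lemma perm_sum_split_block:
  fixes \<phi> :: "'b set \<Rightarrow> 'r::comm_ring_1"
  assumes qs: "\<And>B C. finite B \<Longrightarrow> finite C \<Longrightarrow> B \<noteq> {} \<Longrightarrow> C \<noteq> {} \<Longrightarrow> B \<inter> C = {} \<Longrightarrow>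
      \<phi> B * \<phi> C = \<phi> (B \<union> C) * (\<phi> B + \<phi> C + 1)"
    and "finite S" "i \<in> S"
  shows "perm_sum \<phi> S = (\<Sum>B\<in>subsets_with i S. log_coeff (card B) * \<phi> B * perm_sum \<phi> (S - B))"
  using assms(2,3)
proof (induction "card S" arbitrary: S rule: less_induct)
  case less
  let ?A = "perm_sum \<phi>"
  let ?D = "\<lambda>B. \<Sum>l\<in>S - B. ?A (S - B - {l})"
  \<comment> \<open>The induction hypothesis needs \<open>i\<close> among the remaining letters,
    hence \<open>l \<noteq> i\<close>. The words beginning with \<open>i\<close> are kept as
    \<open>\<phi> S * ?A (S - {i})\<close> and cancel against the telescoping sum at the
    end.\<close>
  have "(\<Sum>l\<in>S - {i}. ?A (S - {l})) =
      (\<Sum>l\<in>S - {i}. \<Sum>B\<in>subsets_with i (S - {l}). log_coeff (card B) * \<phi> B * ?A (S - {l} - B))"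
    using less.prems by (intro sum.cong refl less.hyps card_Diff1_less) auto
  also have "\<dots> = (\<Sum>B\<in>subsets_with i S. \<Sum>l\<in>S - B. log_coeff (card B) * \<phi> B * ?A (S - {l} - B))"
    using less.prems by (rule sum_subsets_swap)
  also have "\<dots> = (\<Sum>B\<in>subsets_with i S. log_coeff (card B) * \<phi> B * ?D B)"
  proof -
    have "S - {l} - B = S - B - {l}" for l B by auto
    then show ?thesis by (simp only: sum_distrib_left)
  qed
  finally have "?A S = \<phi> S * ?A (S - {i}) + (\<Sum>B\<in>subsets_with i S. log_coeff (card B) * (\<phi> S * \<phi> B * ?D B))"
    using less.prems
    by (subst perm_sum_rec) (auto simp: sum.remove[of S i] ring_distribs sum_distrib_left mult_ac)
  \<comment> \<open>This is the quasi-shuffle relation for \<open>B\<close> and \<open>S - B\<close>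
    times \<open>?D B\<close>, where \<open>?A (S - B) = \<phi> (S - B) * ?D B\<close>. For
    \<open>B = S\<close> both sides are 0, since \<open>?D S\<close> is an empty sum and
    \<open>?A {} = 1\<close>.\<close>
  also have "(\<Sum>B\<in>subsets_with i S. log_coeff (card B) * (\<phi> S * \<phi> B * ?D B)) =
     (\<Sum>B\<in>subsets_with i S. log_coeff (card B) * (\<phi> B * ?A (S - B) - \<phi> S * (?A (S - B) + ?D B)))"
  proof (intro sum.cong arg_cong2[of _ _ _ _ "(*)"] refl)
    fix B assume B: "B \<in> subsets_with i S"
    show "\<phi> S * \<phi> B * ?D B = \<phi> B * ?A (S - B) - \<phi> S * (?A (S - B) + ?D B)"
    proof (cases "B = S")
      case False
      have finB: "finite B" using B less.prems finite_subset by blast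
      have A: "?A (S - B) = \<phi> (S - B) * ?D B"
        using False B less.prems by (intro perm_sum_rec) auto
      have "B \<union> (S - B) = S" using B by auto
      moreover have "B \<noteq> {}" "S - B \<noteq> {}" using B False by auto
      ultimately have "\<phi> B * \<phi> (S - B) = \<phi> S * (\<phi> B + \<phi> (S - B) + 1)"
        using qs[of B "S - B"] finB less.prems by auto
      then have "\<phi> B * \<phi> (S - B) * ?D B = \<phi> S * (\<phi> B + \<phi> (S - B) + 1) * ?D B" by simp
      then show ?thesis unfolding A by (simp add: algebra_simps)
    qed simp
  qed
  also have "\<dots> = (\<Sum>B\<in>subsets_with i S. log_coeff (card B) * \<phi> B * ?A (S - B)) -
     \<phi> S * (\<Sum>B\<in>subsets_with i S. log_coeff (card B) * (?A (S - B) + ?D B))"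
    by (simp add: right_diff_distrib sum_subtractf sum_distrib_left mult_ac)
  also have "(\<Sum>B\<in>subsets_with i S. log_coeff (card B) * (?A (S - B) + ?D B)) = ?A (S - {i})"
    using less.prems by (rule sum_log_coeff_telescope)
  finally show ?case by simp
qed

text \<open>The exponential of the weighted function \<open>log_coeff (card B) * \<psi> B\<close> for the product
  \<open>(f * g) S = (\<Sum>T\<subseteq>S. f T * g (S - T))\<close> of set functions.\<close>

function set_exp :: "('b::linorder set \<Rightarrow> 'r::comm_ring_1) \<Rightarrow> 'b set \<Rightarrow> 'r" where
  "set_exp \<psi> T = (if T = {} \<or> infinite T then 1
     else \<Sum>B\<in>subsets_with (Min T) T. log_coeff (card B) * \<psi> B * set_exp \<psi> (T - B))"
  by pat_completeness auto
termination
proof (relation "Wellfounded.measure (\<lambda>(\<psi>, T). card T)", goal_cases)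
  case (2 \<psi> T B)
  then have "T - B \<subset> T" by auto
  then show ?case using 2 by (auto intro: psubset_card_mono)
qed simp

declare set_exp.simps [simp del]

lemma set_exp_empty [simp]: "set_exp \<psi> {} = 1"
  by (simp add: set_exp.simps)

text \<open>Anticipates the canceller times \<open>Z\<close>, summed over orderings of the zero
  letters \<open>S\<close> in front of a fixed tail: \<open>T\<close> goes to the canceller,
  \<open>S - T\<close> to \<open>Z\<close>, and \<open>G\<close> is the contribution of the tail,
  which sees only the total argument in front of it.\<close>

definition weighted_sum ::
    "('b::linorder set \<Rightarrow> 'r::comm_ring_1) \<Rightarrow> ('b set \<Rightarrow> 'r) \<Rightarrow> ('b \<Rightarrow> real) \<Rightarrow> 'b set \<Rightarrow> (real \<Rightarrow> 'r) \<Rightarrow> 'r" where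
  "weighted_sum \<psi> \<phi> r S G = (\<Sum>T\<in>Pow S. set_exp \<psi> T * perm_sum \<phi> (S - T) * G (sum r (S - T)))"

text \<open>The block \<open>B\<close> containing \<open>Min S\<close> comes either from the
  ordering sum, with factor \<open>\<phi> B\<close> and \<open>sum r B\<close> seen by
  \<open>G\<close>, or from the canceller, with factor \<open>\<psi> B\<close> and no shift. Adding
  the two cases merges both exponentials into one recursion.\<close>

lemma weighted_sum_rec:
  fixes \<phi> \<psi> :: "'b::linorder set \<Rightarrow> 'r::comm_ring_1"
  assumes qs: "\<And>B C. finite B \<Longrightarrow> finite C \<Longrightarrow> B \<noteq> {} \<Longrightarrow> C \<noteq> {} \<Longrightarrow> B \<inter> C = {} \<Longrightarrow>
      \<phi> B * \<phi> C = \<phi> (B \<union> C) * (\<phi> B + \<phi> C + 1)"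
    and S: "finite S" "S \<noteq> {}"
  shows "weighted_sum \<psi> \<phi> r S G = (\<Sum>B\<in>subsets_with (Min S) S. log_coeff (card B) *
     weighted_sum \<psi> \<phi> r (S - B) (\<lambda>y. \<phi> B * G (y + sum r B) + \<psi> B * G y))"
proof -
  define i where "i = Min S"
  have i: "i \<in> S" using S by (simp add: i_def)
  have finB: "finite B" if "B \<subseteq> S" for B using that S finite_subset by blast
  let ?E = "set_exp \<psi>" and ?A = "perm_sum \<phi>"
  have "(\<Sum>T\<in>Pow (S - {i}). ?E T * ?A (S - T) * G (sum r (S - T))) =
    (\<Sum>T\<in>Pow (S - {i}). \<Sum>B\<in>subsets_with i (S - T). log_coeff (card B) * \<phi> B * ?A (S - T - B) * ?E T * G (sum r (S - T)))"
    using S i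
    by (intro sum.cong refl, subst perm_sum_split_block[OF qs, of _ i]) (auto simp: sum_distrib_left sum_distrib_right mult_ac)
  also have "\<dots> = (\<Sum>(T, B)\<in>Sigma (Pow (S - {i})) (\<lambda>T. subsets_with i (S - T)). log_coeff (card B) * \<phi> B * ?A (S - T - B) * ?E T * G (sum r (S - T)))"
    using S by (subst sum.Sigma) auto
  also have "\<dots> = (\<Sum>(B, T)\<in>Sigma (subsets_with i S) (\<lambda>B. Pow (S - B)). log_coeff (card B) * \<phi> B * ?A (S - B - T) * ?E T * G (sum r (S - B - T) + sum r B))"
  proof (rule sum.reindex_bij_witness[of _ prod.swap prod.swap], goal_cases)
    case (5 a)
    obtain T B where a: "a = (T, B)" by (cases a)
    with 5 have "B \<subseteq> S - T" "i \<in> B" "T \<subseteq> S" by auto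
    then have "sum r (S - T) = sum r (S - T - B) + sum r B" "S - T - B = S - B - T"
      using S by (auto intro!: sum.subset_diff)
    then show ?case by (simp add: a)
  qed auto
  also have "\<dots> = (\<Sum>B\<in>subsets_with i S. \<Sum>T\<in>Pow (S - B). log_coeff (card B) * \<phi> B * ?A (S - B - T) * ?E T * G (sum r (S - B - T) + sum r B))"
    using S by (subst sum.Sigma) auto
  finally have 1: "(\<Sum>T\<in>Pow (S - {i}). ?E T * ?A (S - T) * G (sum r (S - T))) = \<dots>" .
  have "(\<Sum>T\<in>subsets_with i S. ?E T * ?A (S - T) * G (sum r (S - T))) =
    (\<Sum>T\<in>subsets_with i S. \<Sum>B\<in>subsets_with i T. log_coeff (card B) * \<psi> B * ?E (T - B) * ?A (S - T) * G (sum r (S - T)))"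
  proof (intro sum.cong refl)
    fix T assume T: "T \<in> subsets_with i S"
    \<comment> \<open>Being least in \<open>S\<close>, \<open>i\<close> is least in every
      \<open>T\<close> that contains it, so \<open>set_exp\<close> also splits off the block of
      \<open>i\<close>.\<close>
    then have "Min T = i" using finB S by (auto simp: i_def intro!: Min_eqI)
    then have "?E T = (\<Sum>B\<in>subsets_with i T. log_coeff (card B) * \<psi> B * ?E (T - B))"
      using T finB by (subst set_exp.simps) auto
    then show "?E T * ?A (S - T) * G (sum r (S - T)) =
       (\<Sum>B\<in>subsets_with i T. log_coeff (card B) * \<psi> B * ?E (T - B) * ?A (S - T) * G (sum r (S - T)))"
      by (simp add: sum_distrib_right)
  qed
  also have "\<dots> = (\<Sum>(T, B)\<in>Sigma (subsets_with i S) (subsets_with i). log_coeff (card B) * \<psi> B * ?E (T - B) * ?A (S - T) * G (sum r (S - T)))"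
    using S finB by (subst sum.Sigma) auto
  also have "\<dots> = (\<Sum>(B, T)\<in>Sigma (subsets_with i S) (\<lambda>B. Pow (S - B)). log_coeff (card B) * \<psi> B * ?E T * ?A (S - B - T) * G (sum r (S - B - T)))"
  proof (rule sum.reindex_bij_witness[of _ "\<lambda>(B, T). (T \<union> B, B)" "\<lambda>(T, B). (B, T - B)"], goal_cases)
    case (5 a)
    obtain T B where a: "a = (T, B)" by (cases a)
    with 5 have "B \<subseteq> T" by auto
    then have "S - B - (T - B) = S - T" by auto
    then show ?case by (simp add: a)
  qed auto
  also have "\<dots> = (\<Sum>B\<in>subsets_with i S. \<Sum>T\<in>Pow (S - B). log_coeff (card B) * \<psi> B * ?E T * ?A (S - B - T) * G (sum r (S - B - T)))"
    using S by (subst sum.Sigma) auto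
  finally have 2: "(\<Sum>T\<in>subsets_with i S. ?E T * ?A (S - T) * G (sum r (S - T))) = \<dots>" .
  have "Pow S = Pow (S - {i}) \<union> subsets_with i S" by auto
  then have "weighted_sum \<psi> \<phi> r S G = (\<Sum>T\<in>Pow (S - {i}). ?E T * ?A (S - T) * G (sum r (S - T))) +
     (\<Sum>T\<in>subsets_with i S. ?E T * ?A (S - T) * G (sum r (S - T)))"
    unfolding weighted_sum_def using S by (subst sum.union_disjoint[symmetric]) auto
  also have "\<dots> = (\<Sum>B\<in>subsets_with i S. log_coeff (card B) *
     weighted_sum \<psi> \<phi> r (S - B) (\<lambda>y. \<phi> B * G (y + sum r B) + \<psi> B * G y))"
    unfolding 1 2 weighted_sum_def
    by (simp add: sum.distrib[symmetric] sum_distrib_left algebra_simps)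
  finally show ?thesis by (simp add: i_def)
qed

section \<open>The quasi-shuffle relation and leading zero letters\<close>

lemma scaled_eulerian_0_eq:
  assumes "x \<noteq> 0"
  defines "E \<equiv> fps_to_fls (fps_exp (complex_of_real x))"
  shows "1 - E \<noteq> 0" "scaled_eulerian 0 x = E / (1 - E)"
proof -
  have "E $$ 1 \<noteq> 0" using assms by simp
  then show nz: "1 - E \<noteq> 0" by (metis eq_iff_diff_eq_0 fls_one_nth zero_neq_one)
  define X where "X = fps_const (complex_of_real x) * fps_X"
  have X: "X \<noteq> 0" "fps_nth X 0 = 0" using assms by (auto simp: X_def)
  define E1 where "E1 = fps_exp (1::complex)"
  have "(1 - fps_to_fls E1) $$ 1 \<noteq> 0" by (simp add: E1_def)
  then have E1: "1 - fps_to_fls E1 \<noteq> 0" by (metis fls_zero_nth)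
  have "eulerian_fls 0 * fps_to_fls (1 - E1) = fps_to_fls E1"
    using E1 by (subst eulerian_fls.simps) (simp add: E1_def)
  then have "scaled_eulerian 0 x * fls_compose_fps (fps_to_fls (1 - E1)) X = fls_compose_fps (fps_to_fls E1) X"
    unfolding scaled_eulerian_def X_def[symmetric] by (metis X fls_compose_fps_mult)
  moreover have "fls_compose_fps (fps_to_fls E1) X = E"
    using X by (simp add: E1_def E_def X_def fps_exp_compose_linear)
  moreover have "fls_compose_fps (fps_to_fls (1 - E1)) X = 1 - E"
    by (subst fls_compose_fps_to_fls[OF X]) (simp add: fps_compose_sub_distrib E1_def E_def X_def fps_exp_compose_linear)
  ultimately have "scaled_eulerian 0 x * (1 - E) = E" by (simp only:)
  then show "scaled_eulerian 0 x = E / (1 - E)"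
    using nz by (simp only: nonzero_eq_divide_eq not_False_eq_True)
qed

text \<open>A double sum over l1, l2 \<ge> 1 splits into l1 > l2, l1 < l2 and l1 = l2. For Laurent
  series this is a rational identity in the exponentials \<open>a\<close> and
  \<open>b\<close>.\<close>

lemma scaled_eulerian_quasi_shuffle:
  assumes "x > 0" "y > 0"
  shows "scaled_eulerian 0 x * scaled_eulerian 0 y =
     scaled_eulerian 0 (x + y) * (scaled_eulerian 0 x + scaled_eulerian 0 y + 1)"
proof -
  define a where "a = fps_to_fls (fps_exp (complex_of_real x))"
  define b where "b = fps_to_fls (fps_exp (complex_of_real y))"
  have ab: "fps_to_fls (fps_exp (complex_of_real (x + y))) = a * b"
    by (simp add: a_def b_def fls_times_fps_to_fls[symmetric] fps_exp_add_mult)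
  have nz: "1 - a \<noteq> 0" "1 - b \<noteq> 0" "1 - a * b \<noteq> 0"
    using scaled_eulerian_0_eq(1)[of x] scaled_eulerian_0_eq(1)[of y] scaled_eulerian_0_eq(1)[of "x + y", unfolded ab] assms
    by (simp_all add: a_def b_def)
  have eq: "scaled_eulerian 0 x = a / (1 - a)" "scaled_eulerian 0 y = b / (1 - b)"
      "scaled_eulerian 0 (x + y) = a * b / (1 - a * b)"
    unfolding a_def b_def using assms
    by (auto intro!: scaled_eulerian_0_eq(2) scaled_eulerian_0_eq(2)[of "x + y", unfolded ab, unfolded a_def b_def])
  have "a / (1 - a) + b / (1 - b) + 1 = (1 - a * b) / ((1 - a) * (1 - b))"
    using nz by (simp add: divide_simps) (simp add: algebra_simps)
  then show ?thesis unfolding eq using nz by simp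
qed

fun prefix_prod :: "(real \<Rightarrow> 'r::comm_ring_1) \<Rightarrow> real \<Rightarrow> real list \<Rightarrow> 'r" where
  "prefix_prod f x [] = 1"
| "prefix_prod f x (r # rs) = f (x + r) * prefix_prod f (x + r) rs"

lemma prefix_prod_snoc: "prefix_prod f x (rs @ [r]) = prefix_prod f x rs * f (x + sum_list rs + r)"
  by (induction rs arbitrary: x) (auto simp: add_ac mult_ac)

lemma prefix_prod_eq_suffix_prod:
  "distinct w \<Longrightarrow> prefix_prod f 0 (map r w) = suffix_prod (\<lambda>B. f (sum r B)) (rev w)"
  by (induction w rule: rev_induct)
     (auto simp: prefix_prod_snoc sum_list_distinct_conv_sum_set add_ac mult_ac)

definition shifted_merge_sum :: "(nat \<Rightarrow> real \<Rightarrow> 'b::comm_ring_1) \<Rightarrow> (nat \<times> real) list \<Rightarrow> real \<Rightarrow> 'b" where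
  "shifted_merge_sum F v y = (case v of [] \<Rightarrow> 1 | (m, r) # v' \<Rightarrow> merge_sum F ((m, r + y) # v'))"

text \<open>Exponent 0 leaves only \<open>a = 0\<close> in the binomial sum, so a zero letter passes
  its argument, but no exponent, on to the next letter.\<close>

lemma merge_sum_zeros_aux:
  "merge_sum F ((0, x) # map (Pair 0) rs @ v) =
     F 0 x * prefix_prod (F 0) x rs * shifted_merge_sum F v (x + sum_list rs)"
proof (induction rs arbitrary: x)
  case Nil
  show ?case by (cases v) (auto simp: shifted_merge_sum_def add_ac)
qed (simp add: add_ac mult_ac)

lemma merge_sum_zeros:
  "merge_sum F (map (Pair 0) rs @ v) = prefix_prod (F 0) 0 rs * shifted_merge_sum F v (sum_list rs)"
  by (cases rs) (auto simp: merge_sum_zeros_aux shifted_merge_sum_def split: list.splits)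

lemma sum_perms_merge_sum:
  "(\<Sum>w\<in>permutations_of_set S. merge_sum F (map (\<lambda>i. (0, r i)) w @ v)) =
     perm_sum (\<lambda>B. F 0 (sum r B)) S * shifted_merge_sum F v (sum r S)"
proof -
  have "merge_sum F (map (\<lambda>i. (0, r i)) w @ v) =
      suffix_prod (\<lambda>B. F 0 (sum r B)) (rev w) * shifted_merge_sum F v (sum r S)"
    if "w \<in> permutations_of_set S" for w
  proof -
    have w: "set w = S" "distinct w" using that by (auto dest: permutations_of_setD)
    have "merge_sum F (map (\<lambda>i. (0, r i)) w @ v) = merge_sum F (map (Pair 0) (map r w) @ v)"
      by (simp add: o_def)
    then show ?thesis using w
      by (simp only: merge_sum_zeros prefix_prod_eq_suffix_prod sum_list_distinct_conv_sum_set)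
  qed
  then have "(\<Sum>w\<in>permutations_of_set S. merge_sum F (map (\<lambda>i. (0, r i)) w @ v)) =
     (\<Sum>w\<in>permutations_of_set S. suffix_prod (\<lambda>B. F 0 (sum r B)) (rev w)) * shifted_merge_sum F v (sum r S)"
    by (simp add: sum_distrib_right)
  also have "(\<Sum>w\<in>permutations_of_set S. suffix_prod (\<lambda>B. F 0 (sum r B)) (rev w)) =
      (\<Sum>w\<in>rev ` permutations_of_set S. suffix_prod (\<lambda>B. F 0 (sum r B)) w)"
    by (subst sum.reindex) auto
  finally show ?thesis by (simp add: perm_sum_def)
qed

text \<open>One positive limit in front keeps all partial sums away from 0, even if later arguments
  tend to 0.\<close>

lemma tame_fls_merge_sum:
  assumes "(q \<longlongrightarrow> l) F" "0 < l" "\<And>p. 0 < q p"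
    and "\<And>i p. 0 < x p i" "\<And>i. i \<in> set v \<Longrightarrow> ((\<lambda>p. x p i) \<longlongrightarrow> c i) F"
  shows "tame_fls F (\<lambda>p y. merge_sum scaled_eulerian ((m, q p + y) # map (\<lambda>i. (n i, x p i)) v))"
  using assms
proof (induction v arbitrary: m q l)
  case Nil
  then show ?case by (simp add: tame_fls_scaled_eulerian)
next
  case (Cons i v)
  have c: "c i \<ge> 0" if "F \<noteq> bot"
    using Cons.prems(4,5) that by (intro tendsto_lowerbound[of "\<lambda>p. x p i"]) (auto intro!: always_eventually less_imp_le)
  \<comment> \<open>A limit of positive functions is nonnegative only along a proper filter. Along
    \<open>bot\<close> any limit holds, and \<open>max 0\<close> keeps the claimed one
    positive.\<close>
  have lim: "((\<lambda>p. q p + x p i) \<longlongrightarrow> l + max 0 (c i)) F"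
  proof (cases "F = bot")
    case False
    then show ?thesis using c Cons.prems by (auto intro!: tendsto_add simp: max_def)
  qed simp
  have "tame_fls F (\<lambda>p y. merge_sum scaled_eulerian ((k, q p + x p i + y) # map (\<lambda>i. (n i, x p i)) v))" for k
    using Cons.prems by (intro Cons.IH[OF lim]) (auto intro: add_pos_pos add_pos_nonneg)
  moreover have "q p + x p i + y = q p + y + x p i" for p y by simp
  ultimately have tm: "tame_fls F (\<lambda>p y. merge_sum scaled_eulerian ((k, q p + y + x p i) # map (\<lambda>i. (n i, x p i)) v))" for k
    by simp
  have "tame_fls F (\<lambda>p y. \<Sum>a\<le>m. of_nat (m choose a) * scaled_eulerian a (q p + y) *
       merge_sum scaled_eulerian ((n i + (m - a), q p + y + x p i) # map (\<lambda>i. (n i, x p i)) v))"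
    by (intro tame_fls_sum tame_fls_mult tm tame_fls_scaled_eulerian[OF Cons.prems(1-3)]
      tame_fls_of_convergent convergent_fls_const)
  then show ?case by simp
qed

text \<open>With t the sum over the block, \<phi> G(y + t) + \<psi> G(y) = (\<phi> + \<psi>) G(y +
  t) - \<psi> (G(y + t) - G(y)). Here \<phi> + \<psi> is regular and the last term is
  \<open>fls_X_inv\<close> times a divided difference, so the new function is tame again and the
  induction, general in \<open>G\<close>, applies to \<open>S - B\<close>.\<close>

lemma convergent_fls_weighted_sum:
  fixes x :: "'a \<Rightarrow> 'b::linorder \<Rightarrow> real"
  assumes "finite S" "\<And>i. i \<in> S \<Longrightarrow> ((\<lambda>p. x p i) \<longlongrightarrow> 0) F" "\<And>i p. 0 < x p i" "tame_fls F G"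
  shows "convergent_fls F (\<lambda>p. weighted_sum (\<lambda>B. simple_pole (sum (x p) B))
     (\<lambda>B. scaled_eulerian 0 (sum (x p) B)) (x p) S (G p))"
  using assms
proof (induction "card S" arbitrary: S G rule: less_induct)
  case less
  let ?\<psi> = "\<lambda>p B. simple_pole (sum (x p) B)" and ?\<phi> = "\<lambda>p B. scaled_eulerian 0 (sum (x p) B)"
  show ?case
  proof (cases "S = {}")
    case True
    then show ?thesis using convergent_fls_at_0[OF less.prems(4)] by (simp add: weighted_sum_def)
  next
    case False
    have qs: "?\<phi> p B * ?\<phi> p C = ?\<phi> p (B \<union> C) * (?\<phi> p B + ?\<phi> p C + 1)"
      if "finite B" "finite C" "B \<noteq> {}" "C \<noteq> {}" "B \<inter> C = {}" for B C p
      using that by (simp add: sum.union_disjoint scaled_eulerian_quasi_shuffle sum_pos less.prems)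
    have "convergent_fls F (\<lambda>p. log_coeff (card B) * weighted_sum (?\<psi> p) (?\<phi> p) (x p) (S - B)
        (\<lambda>y. ?\<phi> p B * G p (y + sum (x p) B) + ?\<psi> p B * G p y))" if B: "B \<in> subsets_with (Min S) S" for B
    proof -
      have finB: "finite B" "B \<noteq> {}" using B less.prems(1) finite_subset by auto
      have t: "((\<lambda>p. sum (x p) B) \<longlongrightarrow> 0) F" "\<And>p. 0 < sum (x p) B"
      proof -
        have "((\<lambda>p. sum (x p) B) \<longlongrightarrow> (\<Sum>i\<in>B. 0)) F"
          using B by (intro tendsto_sum less.prems) auto
        then show "((\<lambda>p. sum (x p) B) \<longlongrightarrow> 0) F" by simp
        show "\<And>p. 0 < sum (x p) B" using finB less.prems by (intro sum_pos) auto
      qed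
      let ?t = "\<lambda>p. sum (x p) B"
      have "tame_fls F (\<lambda>p y. (scaled_eulerian 0 (?t p) + simple_pole (?t p)) * G p (y + ?t p) +
          - fls_X_inv * (fls_const (of_real (1 / ?t p)) * (G p (y + ?t p) - G p y)))"
        by (intro tame_fls_add tame_fls_mult tame_fls_shift[OF less.prems(4) t]
            tame_fls_divided_difference[OF less.prems(4) t]
            tame_fls_of_convergent convergent_fls_regular[OF t] convergent_fls_const)
      also have "(\<lambda>p y. (scaled_eulerian 0 (?t p) + simple_pole (?t p)) * G p (y + ?t p) +
          - fls_X_inv * (fls_const (of_real (1 / ?t p)) * (G p (y + ?t p) - G p y))) =
         (\<lambda>p y. ?\<phi> p B * G p (y + sum (x p) B) + ?\<psi> p B * G p y)"
        by (simp add: fun_eq_iff algebra_simps)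
      finally have tm: "tame_fls F (\<lambda>p y. ?\<phi> p B * G p (y + sum (x p) B) + ?\<psi> p B * G p y)" .
      have "card (S - B) < card S"
        using B finB less.prems(1) by (intro psubset_card_mono) auto
      then have "convergent_fls F (\<lambda>p. weighted_sum (?\<psi> p) (?\<phi> p) (x p) (S - B)
        (\<lambda>y. ?\<phi> p B * G p (y + sum (x p) B) + ?\<psi> p B * G p y))"
        using less.prems by (intro less.hyps tm) auto
      then show ?thesis by (intro convergent_fls_mult convergent_fls_const)
    qed
    then have "convergent_fls F (\<lambda>p. \<Sum>B\<in>subsets_with (Min S) S. log_coeff (card B) *
        weighted_sum (?\<psi> p) (?\<phi> p) (x p) (S - B) (\<lambda>y. ?\<phi> p B * G p (y + sum (x p) B) + ?\<psi> p B * G p y))"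
      by (rule convergent_fls_sum)
    moreover have "weighted_sum (?\<psi> p) (?\<phi> p) (x p) S (G p) = (\<Sum>B\<in>subsets_with (Min S) S. log_coeff (card B) *
        weighted_sum (?\<psi> p) (?\<phi> p) (x p) (S - B) (\<lambda>y. ?\<phi> p B * G p (y + sum (x p) B) + ?\<psi> p B * G p y))" for p
      by (rule weighted_sum_rec) (use qs less.prems(1) False in auto)
    ultimately show ?thesis by (simp only:)
  qed
qed

section \<open>Symmetrized Birkhoff decomposition\<close>

text \<open>The product dual to deconcatenation of words, in which the Birkhoff decomposition takes
  place.\<close>

definition convolve :: "('b list \<Rightarrow> 'r::comm_ring_1) \<Rightarrow> ('b list \<Rightarrow> 'r) \<Rightarrow> 'b list \<Rightarrow> 'r" where
  "convolve \<phi> \<psi> w = (\<Sum>j\<le>length w. \<phi> (take j w) * \<psi> (drop j w))"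

lemma convolve_assoc: "convolve (convolve \<phi> \<psi>) \<theta> w = convolve \<phi> (convolve \<psi> \<theta>) w"
proof -
  let ?n = "length w"
  have "convolve (convolve \<phi> \<psi>) \<theta> w =
     (\<Sum>(j, i)\<in>Sigma {..?n} (\<lambda>j. {..j}). \<phi> (take i w) * \<psi> (drop i (take j w)) * \<theta> (drop j w))"
    unfolding convolve_def by (subst sum.Sigma[symmetric]) (auto simp: sum_distrib_right min_def intro!: sum.cong)
  also have "\<dots> = (\<Sum>(i, k)\<in>Sigma {..?n} (\<lambda>i. {..?n - i}). \<phi> (take i w) * (\<psi> (take k (drop i w)) * \<theta> (drop (k + i) w)))"
    by (rule sum.reindex_bij_witness[of _ "\<lambda>(i, k). (k + i, i)" "\<lambda>(j, i). (i, j - i)"])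
       (auto simp: drop_take mult.assoc)
  also have "\<dots> = convolve \<phi> (convolve \<psi> \<theta>) w"
    unfolding convolve_def by (subst sum.Sigma[symmetric]) (auto simp: sum_distrib_left intro!: sum.cong)
  finally show ?thesis .
qed

lemma convolve_eq:
  "convolve \<phi> \<psi> w = \<phi> w * \<psi> [] + (\<Sum>j<length w. \<phi> (take j w) * \<psi> (drop j w))"
  unfolding convolve_def by (simp flip: lessThan_Suc_atMost)

text \<open>An orbit of the class-preserving permutations, given by a set of letters and a pattern
  of classes. In this form segments of its words are again of the same kind; if the classes of
  \<open>U\<close> do not fit the pattern, the set is empty.\<close>

definition orderings :: "('b \<Rightarrow> 'c) \<Rightarrow> 'b set \<Rightarrow> 'b list \<Rightarrow> 'b list set" where
  "orderings c U w\<^sub>0 = {w \<in> permutations_of_set U. map c w = map c w\<^sub>0}"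

definition symmetrize :: "('b \<Rightarrow> 'c) \<Rightarrow> ('b list \<Rightarrow> 'r::comm_ring_1) \<Rightarrow> 'b set \<Rightarrow> 'b list \<Rightarrow> 'r" where
  "symmetrize c \<phi> U w\<^sub>0 = (\<Sum>w\<in>orderings c U w\<^sub>0. \<phi> w)"

lemma finite_orderings [simp]: "finite (orderings c U w\<^sub>0)"
  by (simp add: orderings_def)

lemma length_orderings: "w \<in> orderings c U w\<^sub>0 \<Longrightarrow> length w = length w\<^sub>0"
  by (auto simp: orderings_def dest: map_eq_imp_length_eq)

lemma orderings_Nil: "orderings c U [] = (if U = {} then {[]} else {})"
  by (auto simp: orderings_def permutations_of_set_def)

text \<open>Cutting a word at \<open>j\<close> cuts the pattern at \<open>j\<close> and distributes
  the letters as \<open>V\<close> and \<open>U - V\<close>. This makes symmetrization compatible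
  with \<open>convolve\<close>.\<close>

lemma sum_orderings_split:
  assumes U: "finite U" and j: "j \<le> length w\<^sub>0"
  shows "(\<Sum>w\<in>orderings c U w\<^sub>0. f (take j w) (drop j w)) =
    (\<Sum>V\<in>Pow U. \<Sum>u\<in>orderings c V (take j w\<^sub>0). \<Sum>v\<in>orderings c (U - V) (drop j w\<^sub>0). f u v)"
proof -
  have "(\<Sum>w\<in>orderings c U w\<^sub>0. f (take j w) (drop j w)) =
    (\<Sum>(V, u, v)\<in>Sigma (Pow U) (\<lambda>V. orderings c V (take j w\<^sub>0) \<times> orderings c (U - V) (drop j w\<^sub>0)). f u v)"
  proof (rule sum.reindex_bij_witness[of _ "\<lambda>(V, u, v). u @ v" "\<lambda>w. (set (take j w), take j w, drop j w)"], goal_cases)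
    case (2 w)
    then have w: "set w = U" "distinct w" "map c w = map c w\<^sub>0"
      by (auto simp: orderings_def permutations_of_set_def)
    have "set (take j w) \<inter> set (drop j w) = {}" "set (take j w) \<union> set (drop j w) = set w"
      using w(2) by (metis append_take_drop_id distinct_append, metis append_take_drop_id set_append)
    then have "set (drop j w) = U - set (take j w)" "set (take j w) \<subseteq> U" using w(1) by auto
    then show ?case using w
      by (auto simp: orderings_def permutations_of_set_def simp flip: take_map drop_map)
  next
    case (3 a)
    obtain V u v where a: "a = (V, u, v)" by (cases a)
    with 3 have u: "u \<in> orderings c V (take j w\<^sub>0)" by auto
    from length_orderings[OF u] j have "length u = j" by simp
    moreover have "set u = V" using u by (simp add: orderings_def permutations_of_set_def)
    ultimately show ?case by (simp add: a)
  next
    case (4 a)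
    obtain V u v where a: "a = (V, u, v)" by (cases a)
    with 4 have "map c (u @ v) = map c (take j w\<^sub>0 @ drop j w\<^sub>0)" "V \<subseteq> U"
       "u \<in> permutations_of_set V" "v \<in> permutations_of_set (U - V)"
      unfolding map_append by (auto simp: orderings_def)
    then show ?case by (auto simp: orderings_def a permutations_of_set_def)
  qed auto
  also have "\<dots> = (\<Sum>V\<in>Pow U. \<Sum>(u, v)\<in>orderings c V (take j w\<^sub>0) \<times> orderings c (U - V) (drop j w\<^sub>0). f u v)"
    using U by (subst sum.Sigma[symmetric]) auto
  also have "\<dots> = (\<Sum>V\<in>Pow U. \<Sum>u\<in>orderings c V (take j w\<^sub>0). \<Sum>v\<in>orderings c (U - V) (drop j w\<^sub>0). f u v)"
    by (simp add: sum.cartesian_product)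
  finally show ?thesis .
qed

lemma sum_symmetrize_split:
  assumes "finite U" "\<And>j. j \<in> J \<Longrightarrow> j \<le> length w\<^sub>0"
  shows "(\<Sum>w\<in>orderings c U w\<^sub>0. \<Sum>j\<in>J. \<phi> (take j w) * \<psi> (drop j w)) =
    (\<Sum>j\<in>J. \<Sum>V\<in>Pow U. symmetrize c \<phi> V (take j w\<^sub>0) * symmetrize c \<psi> (U - V) (drop j w\<^sub>0))"
  unfolding symmetrize_def sum_product using assms
  by (subst sum.swap) (intro sum.cong refl sum_orderings_split, auto)

lemma symmetrize_convolve:
  assumes "finite U"
  shows "symmetrize c (convolve \<phi> \<psi>) U w\<^sub>0 =
    (\<Sum>j\<le>length w\<^sub>0. \<Sum>V\<in>Pow U. symmetrize c \<phi> V (take j w\<^sub>0) * symmetrize c \<psi> (U - V) (drop j w\<^sub>0))"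
  using assms sum_symmetrize_split[of U "{..length w\<^sub>0}" w\<^sub>0, where c = c and \<phi> = \<phi> and \<psi> = \<psi>]
  by (simp add: symmetrize_def convolve_def length_orderings)

text \<open>A constant class map makes every permutation an admissible ordering; for given
  \<open>T\<close> only the cut at \<open>card T\<close> contributes.\<close>

lemma sum_permutations_convolve:
  assumes "finite S"
  shows "(\<Sum>w\<in>permutations_of_set S. convolve \<phi> \<psi> w) =
    (\<Sum>T\<in>Pow S. (\<Sum>w\<in>permutations_of_set T. \<phi> w) * (\<Sum>w\<in>permutations_of_set (S - T). \<psi> w))"
proof -
  let ?u = "\<lambda>_. ()"
  have ord: "orderings ?u T w = (if length w = card T then permutations_of_set T else {})" if "T \<subseteq> S" for T and w
    by (auto simp: orderings_def map_replicate_const length_finite_permutations_of_set)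
  obtain w\<^sub>0 where w\<^sub>0: "set w\<^sub>0 = S" "distinct w\<^sub>0" using assms finite_distinct_list by blast
  then have len: "length w\<^sub>0 = card S" using distinct_card by force
  have "(\<Sum>w\<in>permutations_of_set S. convolve \<phi> \<psi> w) = symmetrize ?u (convolve \<phi> \<psi>) S w\<^sub>0"
    by (simp add: symmetrize_def ord len)
  also have "\<dots> = (\<Sum>T\<in>Pow S. \<Sum>j\<le>card S. symmetrize ?u \<phi> T (take j w\<^sub>0) * symmetrize ?u \<psi> (S - T) (drop j w\<^sub>0))"
    unfolding symmetrize_convolve[OF assms] len by (rule sum.swap)
  also have "\<dots> = (\<Sum>T\<in>Pow S. (\<Sum>w\<in>permutations_of_set T. \<phi> w) * (\<Sum>w\<in>permutations_of_set (S - T). \<psi> w))"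
  proof (rule sum.cong)
    fix T assume "T \<in> Pow S"
    then have T: "T \<subseteq> S" "card T \<le> card S" "card (S - T) = card S - card T"
      using assms by (auto intro: card_mono card_Diff_subset finite_subset)
    have "(\<Sum>j\<le>card S. symmetrize ?u \<phi> T (take j w\<^sub>0) * symmetrize ?u \<psi> (S - T) (drop j w\<^sub>0)) =
      (\<Sum>j\<le>card S. if j = card T then (\<Sum>w\<in>permutations_of_set T. \<phi> w) * (\<Sum>w\<in>permutations_of_set (S - T). \<psi> w) else 0)"
      using T by (intro sum.cong) (auto simp: symmetrize_def ord len min_def)
    also have "\<dots> = (\<Sum>w\<in>permutations_of_set T. \<phi> w) * (\<Sum>w\<in>permutations_of_set (S - T). \<psi> w)"
      using T by simp
    finally show "(\<Sum>j\<le>card S. symmetrize ?u \<phi> T (take j w\<^sub>0) * symmetrize ?u \<psi> (S - T) (drop j w\<^sub>0)) =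
      (\<Sum>w\<in>permutations_of_set T. \<phi> w) * (\<Sum>w\<in>permutations_of_set (S - T). \<psi> w)" .
  qed simp
  finally show ?thesis .
qed

lemma polar_set_exp:
  assumes "finite T" "T \<noteq> {}" "\<And>B. polar (\<psi> B)"
  shows "polar (set_exp \<psi> T)"
  using assms(1,2)
proof (induction "card T" arbitrary: T rule: less_induct)
  case less
  have "polar (log_coeff (card B) * \<psi> B * set_exp \<psi> (T - B))" if B: "B \<in> subsets_with (Min T) T" for B
  proof -
    have lc: "log_coeff (card B) = fls_const (log_coeff (card B))"
      by (simp add: log_coeff_def fls_of_nat fls_const_power fls_const_mult_const[symmetric] del: of_nat_fact fls_const_mult_const)
    have "polar (\<psi> B * set_exp \<psi> (T - B))"
    proof (cases "T - B = {}")
      case True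
      then show ?thesis by (simp only: set_exp_empty mult_1_right assms(3))
    next
      case False
      have "card (T - B) < card T" using B less.prems by (intro psubset_card_mono) auto
      then show ?thesis using less False assms(3) by (intro polar_mult) auto
    qed
    then show ?thesis by (subst lc) (simp add: mult.assoc polar_const_mult del: fls_const_mult_const)
  qed
  then show ?case using less.prems by (subst set_exp.simps) (auto intro: polar_sum)
qed

lemma polar_simple_pole: "polar (simple_pole r)"
  by (simp add: polar_def)

text \<open>Positivity holds for every \<open>p\<close>, not just eventually, because the algebraic
  identities and the order bounds are claimed for all \<open>p\<close>. The classes \<open>c\<close>
  model the blocks.\<close>

locale positive_words =
  fixes F :: "'a filter" and x :: "'a \<Rightarrow> 'b::linorder \<Rightarrow> real" and m :: "'b \<Rightarrow> nat" and c :: "'b \<Rightarrow> 'c"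
  assumes x_pos: "0 < x p i"
    and x_lim: "((\<lambda>p. x p i) \<longlongrightarrow> real (m i)) F"
    and c_zero: "c i = c j \<Longrightarrow> m i = 0 \<longleftrightarrow> m j = 0"
begin

definition Z :: "'a \<Rightarrow> 'b list \<Rightarrow> complex fls" where
  "Z p w = merge_sum scaled_eulerian (map (\<lambda>i. (m i, x p i)) w)"

text \<open>A polar factor that removes the poles of \<open>Z\<close> along \<open>x\<^sub>i + \<dots> + x\<^sub>j = 0\<close> for the initial
  letters with \<open>m = 0\<close>. Only its sum over all orderings of such letters matters.\<close>

definition pole_canceller :: "'a \<Rightarrow> 'b list \<Rightarrow> complex fls" where
  "pole_canceller p w = (if \<forall>i\<in>set w. m i = 0
     then fls_const (1 / fact (length w)) * set_exp (\<lambda>B. simple_pole (sum (x p) B)) (set w) else 0)"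

lemma pole_canceller_Nil [simp]: "pole_canceller p [] = 1"
  by (simp add: pole_canceller_def)

lemma polar_pole_canceller:
  assumes "w \<noteq> []"
  shows "polar (pole_canceller p w)"
proof -
  have "polar (fls_const (1 / fact (length w)) * set_exp (\<lambda>B. simple_pole (sum (x p) B)) (set w))"
    by (intro polar_const_mult polar_set_exp polar_simple_pole) (use assms in auto)
  then show ?thesis
    by (auto simp only: pole_canceller_def polar_0 split: if_split)
qed

text \<open>The factor \<open>1 / fact (length w)\<close> spreads \<open>set_exp\<close> evenly over
  all orderings of \<open>T\<close>.\<close>

lemma sum_pole_canceller:
  assumes "finite T" "\<And>i. i \<in> T \<Longrightarrow> m i = 0"
  shows "(\<Sum>w\<in>permutations_of_set T. pole_canceller p w) = set_exp (\<lambda>B. simple_pole (sum (x p) B)) T"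
proof -
  let ?E = "set_exp (\<lambda>B. simple_pole (sum (x p) B)) T"
  have "(\<Sum>w\<in>permutations_of_set T. pole_canceller p w) =
      (\<Sum>w\<in>permutations_of_set T. fls_const (1 / fact (card T)) * ?E)"
    using assms by (intro sum.cong) (auto simp: pole_canceller_def length_finite_permutations_of_set dest: permutations_of_setD)
  also have "\<dots> = fls_const (fact (card T)) * fls_const (1 / fact (card T)) * ?E"
    using assms by (simp add: fls_of_nat mult.assoc del: fls_const_mult_const)
  also have "\<dots> = ?E" by simp
  finally show ?thesis .
qed

lemma sum_convolve_pole_canceller:
  assumes S: "finite S" "\<And>i. i \<in> S \<Longrightarrow> m i = 0" and v: "v = [] \<or> m (hd v) \<noteq> 0"
  shows "(\<Sum>w\<in>permutations_of_set S. convolve (pole_canceller p) (Z p) (w @ v)) =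
     weighted_sum (\<lambda>B. simple_pole (sum (x p) B)) (\<lambda>B. scaled_eulerian 0 (sum (x p) B)) (x p) S
       (shifted_merge_sum scaled_eulerian (map (\<lambda>i. (m i, x p i)) v))"
proof -
  have "convolve (pole_canceller p) (Z p) (w @ v) = convolve (pole_canceller p) (\<lambda>u. Z p (u @ v)) w" for w
  proof -
    \<comment> \<open>A cut beyond \<open>w\<close> would give the canceller the first letter of
      \<open>v\<close>, whose exponent is not 0.\<close>
    have "pole_canceller p (take j (w @ v)) = 0" if "j \<in> {..length (w @ v)} - {..length w}" for j
    proof -
      from that have "v \<noteq> []" "0 < j - length w" by auto
      then have "hd v \<in> set (take j (w @ v))" by (cases v) (auto simp: take_Cons')
      then show ?thesis using v \<open>v \<noteq> []\<close> by (auto simp: pole_canceller_def)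
    qed
    then have "convolve (pole_canceller p) (Z p) (w @ v) =
       (\<Sum>j\<le>length w. pole_canceller p (take j (w @ v)) * Z p (drop j (w @ v)))"
      unfolding convolve_def by (intro sum.mono_neutral_right) auto
    then show ?thesis by (simp add: convolve_def)
  qed
  then have "(\<Sum>w\<in>permutations_of_set S. convolve (pole_canceller p) (Z p) (w @ v)) =
    (\<Sum>T\<in>Pow S. (\<Sum>w\<in>permutations_of_set T. pole_canceller p w) * (\<Sum>w\<in>permutations_of_set (S - T). Z p (w @ v)))"
    by (simp add: sum_permutations_convolve[OF S(1)])
  also have "\<dots> = (\<Sum>T\<in>Pow S. set_exp (\<lambda>B. simple_pole (sum (x p) B)) T *
      (perm_sum (\<lambda>B. scaled_eulerian 0 (sum (x p) B)) (S - T) *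
        shifted_merge_sum scaled_eulerian (map (\<lambda>i. (m i, x p i)) v) (sum (x p) (S - T))))"
  proof (intro sum.cong refl arg_cong2[of _ _ _ _ "(*)"])
    fix T assume T: "T \<in> Pow S"
    then show "(\<Sum>w\<in>permutations_of_set T. pole_canceller p w) = set_exp (\<lambda>B. simple_pole (sum (x p) B)) T"
      using S by (intro sum_pole_canceller) (auto intro: finite_subset)
    have "Z p (w @ v) = merge_sum scaled_eulerian (map (\<lambda>i. (0, x p i)) w @ map (\<lambda>i. (m i, x p i)) v)"
      if "w \<in> permutations_of_set (S - T)" for w
    proof -
      have "map (\<lambda>i. (m i, x p i)) w = map (\<lambda>i. (0, x p i)) w"
        using that S(2) by (auto dest: permutations_of_setD)
      then show ?thesis by (simp only: Z_def map_append)
    qed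
    then show "(\<Sum>w\<in>permutations_of_set (S - T). Z p (w @ v)) =
      perm_sum (\<lambda>B. scaled_eulerian 0 (sum (x p) B)) (S - T) *
        shifted_merge_sum scaled_eulerian (map (\<lambda>i. (m i, x p i)) v) (sum (x p) (S - T))"
      by (simp add: sum_perms_merge_sum[symmetric])
  qed
  finally show ?thesis by (simp add: weighted_sum_def mult.assoc)
qed

lemma tame_fls_shifted_merge_sum:
  assumes "v = [] \<or> m (hd v) \<noteq> 0"
  shows "tame_fls F (\<lambda>p. shifted_merge_sum scaled_eulerian (map (\<lambda>i. (m i, x p i)) v))"
proof (cases v)
  case Nil
  then show ?thesis
    by (simp add: shifted_merge_sum_def[abs_def] tame_fls_of_convergent convergent_fls_const)
next
  case (Cons i v')
  have "tame_fls F (\<lambda>p y. merge_sum scaled_eulerian ((m i, x p i + y) # map (\<lambda>i. (m i, x p i)) v'))"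
    by (rule tame_fls_merge_sum[OF x_lim]) (use assms Cons x_pos x_lim in auto)
  then show ?thesis by (simp add: Cons shifted_merge_sum_def[abs_def])
qed

text \<open>Puts each run of consecutive zero letters into one class, so that symmetrization reaches
  all its orderings; segments inherit this.\<close>

definition regular_word :: "'b list \<Rightarrow> bool" where
  "regular_word w \<longleftrightarrow> successively (\<lambda>i j. m i = 0 \<and> m j = 0 \<longrightarrow> c i = c j) w"

lemma regular_word_append: "regular_word (u @ v) \<Longrightarrow> regular_word u \<and> regular_word v"
  by (simp add: regular_word_def successively_append_iff)

lemma regular_word_take: "regular_word w \<Longrightarrow> regular_word (take j w)"
  and regular_word_drop: "regular_word w \<Longrightarrow> regular_word (drop j w)"
  using regular_word_append[of "take j w" "drop j w"] by simp_all

lemma regular_word_zeros: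
  assumes "regular_word w" "\<forall>i\<in>set w. m i = 0" "i \<in> set w" "j \<in> set w"
  shows "c i = c j"
proof -
  have "c i = c (hd w)" if "regular_word w" "\<forall>i\<in>set w. m i = 0" "i \<in> set w" for w i
    using that
  proof (induction w)
    case (Cons a w)
    then show ?case by (cases "w = []") (auto simp: regular_word_def successively_Cons)
  qed simp
  with assms show ?thesis by metis
qed

text \<open>The pattern is cut after its leading run \<open>a\<close> of zero letters. That run lies
  in one class, so the words fitting it are all permutations of \<open>V\<close>, and for each tail
  \<open>v\<close> the sum over them is a \<open>weighted_sum\<close>.\<close>

lemma convergent_symmetrize_convolve_pole_canceller:
  assumes U: "finite U" and w\<^sub>0: "regular_word w\<^sub>0"
  shows "convergent_fls F (\<lambda>p. symmetrize c (convolve (pole_canceller p) (Z p)) U w\<^sub>0)"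
proof -
  define a b where "a = takeWhile (\<lambda>i. m i = 0) w\<^sub>0" and "b = dropWhile (\<lambda>i. m i = 0) w\<^sub>0"
  define j where "j = length a"
  have ab: "take j w\<^sub>0 = a" "drop j w\<^sub>0 = b" "j \<le> length w\<^sub>0"
    by (auto simp: j_def a_def b_def takeWhile_eq_take[symmetric] dropWhile_eq_drop[symmetric] length_takeWhile_le)
  have a0: "\<forall>i\<in>set a. m i = 0" by (auto simp: a_def dest: set_takeWhileD)
  have ac: "c i = c i'" if "i \<in> set a" "i' \<in> set a" for i i'
    using regular_word_zeros[OF regular_word_take[OF w\<^sub>0, of j]] ab that a0 by metis
  have b0: "b = [] \<or> m (hd b) \<noteq> 0" unfolding b_def using hd_dropWhile[of "\<lambda>i. m i = 0" w\<^sub>0] by blast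
  have inner: "convergent_fls F (\<lambda>p. \<Sum>u\<in>orderings c V a. convolve (pole_canceller p) (Z p) (u @ v))"
    if V: "V \<subseteq> U" and v: "v \<in> orderings c (U - V) b" for V v
  proof (cases "orderings c V a = {}")
    case True
    then show ?thesis by (simp add: convergent_fls_const)
  next
    case False
    then obtain u where u: "set u = V" "distinct u" "map c u = map c a"
      by (auto simp: orderings_def permutations_of_set_def)
    have cV: "\<exists>i'\<in>set a. c i = c i'" if "i \<in> V" for i
      using that u by (metis imageE imageI set_map)
    then have V0: "m i = 0" if "i \<in> V" for i using that a0 c_zero by metis
    have finV: "finite V" using V U finite_subset by blast
    have "orderings c V a = permutations_of_set V"
    proof -
      have "map c u' = map c a" if "u' \<in> permutations_of_set V" for u'
      proof (rule nth_equalityI)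
        have "length u' = length u" using that u
          by (metis distinct_card length_finite_permutations_of_set)
        then show len: "length (map c u') = length (map c a)" using u(3) by (metis length_map)
        fix k assume k: "k < length (map c u')"
        then have "u' ! k \<in> V" "a ! k \<in> set a" using that len by (auto dest: permutations_of_setD)
        then show "map c u' ! k = map c a ! k" using cV ac k len by (metis length_map nth_map)
      qed
      then show ?thesis by (auto simp: orderings_def)
    qed
    moreover have vb: "v = [] \<or> m (hd v) \<noteq> 0"
    proof -
      have "map c v = map c b" using v by (simp add: orderings_def)
      then show ?thesis using b0 c_zero by (metis list.map_sel(1) Nil_is_map_conv)
    qed
    ultimately have eq: "(\<Sum>u\<in>orderings c V a. convolve (pole_canceller p) (Z p) (u @ v)) =
      weighted_sum (\<lambda>B. simple_pole (sum (x p) B)) (\<lambda>B. scaled_eulerian 0 (sum (x p) B)) (x p) V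
        (shifted_merge_sum scaled_eulerian (map (\<lambda>i. (m i, x p i)) v))" for p
      using sum_convolve_pole_canceller[of V v p] V0 finV by simp
    have "((\<lambda>p. x p i) \<longlongrightarrow> 0) F" if "i \<in> V" for i
      using x_lim[of i] V0[OF that] by simp
    then show ?thesis
      unfolding eq
      by (intro convergent_fls_weighted_sum tame_fls_shifted_merge_sum vb x_pos finV)
  qed
  have "convergent_fls F (\<lambda>p. \<Sum>V\<in>Pow U. \<Sum>v\<in>orderings c (U - V) b. \<Sum>u\<in>orderings c V a. convolve (pole_canceller p) (Z p) (u @ v))"
    by (rule convergent_fls_sum, rule convergent_fls_sum, rule inner) auto
  moreover have "symmetrize c (convolve (pole_canceller p) (Z p)) U w\<^sub>0 =
     (\<Sum>V\<in>Pow U. \<Sum>v\<in>orderings c (U - V) b. \<Sum>u\<in>orderings c V a. convolve (pole_canceller p) (Z p) (u @ v))" for p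
  proof -
    have "symmetrize c (convolve (pole_canceller p) (Z p)) U w\<^sub>0 =
       (\<Sum>V\<in>Pow U. \<Sum>u\<in>orderings c V a. \<Sum>v\<in>orderings c (U - V) b. convolve (pole_canceller p) (Z p) (u @ v))"
      using sum_orderings_split[OF U ab(3), where c = c and f = "\<lambda>u v. convolve (pole_canceller p) (Z p) (u @ v)"]
      by (simp only: ab(1,2) append_take_drop_id symmetrize_def)
    also have "\<dots> = (\<Sum>V\<in>Pow U. \<Sum>v\<in>orderings c (U - V) b. \<Sum>u\<in>orderings c V a. convolve (pole_canceller p) (Z p) (u @ v))"
      by (intro sum.cong refl sum.swap)
    finally show ?thesis .
  qed
  ultimately show ?thesis by (simp only:)
qed

text \<open>Right division of \<open>N\<close> by \<open>pole_canceller\<close> with respect to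
  \<open>convolve\<close>, possible because the canceller is 1 on the empty word.\<close>

function quotient :: "('b list \<Rightarrow> complex fls) \<Rightarrow> 'a \<Rightarrow> 'b list \<Rightarrow> complex fls" where
  "quotient N p w = N w - (\<Sum>j<length w. quotient N p (take j w) * pole_canceller p (drop j w))"
  by pat_completeness auto
termination by (relation "Wellfounded.measure (\<lambda>(N, p, w). length w)") auto

declare quotient.simps [simp del]

lemma quotient_Nil: "quotient N p [] = N []"
  by (subst quotient.simps) simp

lemma convolve_quotient: "convolve (quotient N p) (pole_canceller p) w = N w"
  unfolding convolve_eq by (subst quotient.simps) simp

lemma polar_quotient:
  assumes "N [] = 1" "\<And>w. w \<noteq> [] \<Longrightarrow> polar (N w)" "w \<noteq> []"
  shows "polar (quotient N p w)"
  using assms(3)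
proof (induction "length w" arbitrary: w rule: less_induct)
  case less
  have "polar (quotient N p (take j w) * pole_canceller p (drop j w))" if "j < length w" for j
  proof (cases "j = 0")
    case True
    then show ?thesis using less.prems assms(1) by (simp add: quotient_Nil polar_pole_canceller)
  next
    case False
    then show ?thesis using that less.prems by (intro polar_mult less.hyps polar_pole_canceller) auto
  qed
  then show ?case using less.prems assms(2)
    by (subst quotient.simps) (auto intro!: polar_diff polar_sum)
qed

text \<open>Replacing \<open>N\<close> by its quotient and \<open>Z\<close> by its product with the pole canceller leaves the
  regular factor of the Birkhoff decomposition unchanged.\<close>

theorem convergent_symmetrize_birkhoff:
  assumes N: "\<And>p. N p [] = 1" "\<And>p w. w \<noteq> [] \<Longrightarrow> polar (N p w)"
    and reg: "\<And>p w. w \<noteq> [] \<Longrightarrow> Ppart (convolve (N p) (Z p) w) = 0"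
    and U: "finite U" and w\<^sub>0: "regular_word w\<^sub>0"
  shows "convergent_fls F (\<lambda>p. symmetrize c (convolve (N p) (Z p)) U w\<^sub>0)"
proof -
  define Y where "Y = (\<lambda>p. quotient (N p) p)"
  define Z' where "Z' = (\<lambda>p. convolve (pole_canceller p) (Z p))"
  have NZ: "convolve (N p) (Z p) w = convolve (Y p) (Z' p) w" for p w
  proof -
    have "convolve (N p) (Z p) w = convolve (convolve (Y p) (pole_canceller p)) (Z p) w"
      unfolding Y_def convolve_quotient[abs_def] ..
    then show ?thesis unfolding Z'_def by (simp only: convolve_assoc)
  qed
  have Z'_Nil: "Z' p [] = 1" for p by (simp add: Z'_def convolve_def Z_def)
  have convZ': "convergent_fls F (\<lambda>p. symmetrize c (Z' p) U w)" if "finite U" "regular_word w" for U w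
    unfolding Z'_def using that by (rule convergent_symmetrize_convolve_pole_canceller)
  \<comment> \<open>\<open>Y\<close> is polar and its product with \<open>Z'\<close> has no polar
    part on nonempty words, so \<open>Ppart\<close> determines \<open>Y\<close> from shorter words.
    This is the uniqueness of the decomposition.\<close>
  have Y_rec: "Y p w = - Ppart (\<Sum>j<length w. Y p (take j w) * Z' p (drop j w))" if "w \<noteq> []" for p w
  proof -
    have "Y p w = convolve (N p) (Z p) w - (\<Sum>j<length w. Y p (take j w) * Z' p (drop j w))"
      by (simp only: NZ convolve_eq[of "Y p"] Z'_Nil mult_1_right add_diff_cancel_right')
    moreover have "Ppart (Y p w) = Y p w"
      unfolding Y_def by (intro Ppart_polar polar_quotient N that)
    ultimately have "Y p w = Ppart (convolve (N p) (Z p) w - (\<Sum>j<length w. Y p (take j w) * Z' p (drop j w)))"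
      by metis
    then show ?thesis unfolding Ppart_diff reg[OF that] by (simp only: diff_0)
  qed
  have convY: "convergent_fls F (\<lambda>p. symmetrize c (Y p) U w)" if "finite U" "regular_word w" for U w
    using that
  proof (induction "length w" arbitrary: w U rule: less_induct)
    case less
    show ?case
    proof (cases "w = []")
      case True
      have "Y p [] = 1" for p by (simp add: Y_def quotient_Nil N)
      then show ?thesis by (simp add: True symmetrize_def orderings_Nil convergent_fls_const)
    next
      case False
      \<comment> \<open>\<open>Ppart\<close> is additive and passes through the sum over orderings,
        so the symmetrizations of \<open>Y\<close> obey a recursion of their own that involves only
        symmetrized factors.\<close>
      have "symmetrize c (Y p) U w =
          (\<Sum>u\<in>orderings c U w. - Ppart (\<Sum>j<length w. Y p (take j u) * Z' p (drop j u)))" for p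
        unfolding symmetrize_def
      proof (rule sum.cong)
        fix u assume u: "u \<in> orderings c U w"
        have len: "length u = length w" by (rule length_orderings[OF u])
        with False have "u \<noteq> []" by auto
        then show "Y p u = - Ppart (\<Sum>j<length w. Y p (take j u) * Z' p (drop j u))"
          using Y_rec[of u p, unfolded len] by blast
      qed simp
      then have "symmetrize c (Y p) U w =
        - Ppart (\<Sum>u\<in>orderings c U w. \<Sum>j<length w. Y p (take j u) * Z' p (drop j u))" for p
        by (simp only: sum_negf Ppart_sum)
      moreover have "(\<Sum>u\<in>orderings c U w. \<Sum>j<length w. Y p (take j u) * Z' p (drop j u)) =
         (\<Sum>j<length w. \<Sum>V\<in>Pow U. symmetrize c (Y p) V (take j w) * symmetrize c (Z' p) (U - V) (drop j w))" for p
        by (rule sum_symmetrize_split) (use less.prems in auto)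
      ultimately have eq: "symmetrize c (Y p) U w = - Ppart (\<Sum>j<length w. \<Sum>V\<in>Pow U.
          symmetrize c (Y p) V (take j w) * symmetrize c (Z' p) (U - V) (drop j w))" for p
        by (simp only:)
      show ?thesis unfolding eq
        by (intro convergent_fls_Ppart convergent_fls_sum convergent_fls_mult less.hyps convZ'
            regular_word_take regular_word_drop) (use less.prems in \<open>auto intro: finite_subset\<close>)
    qed
  qed
  have "convergent_fls F (\<lambda>p. symmetrize c (convolve (Y p) (Z' p)) U w\<^sub>0)"
    unfolding symmetrize_convolve[OF U]
    by (intro convergent_fls_sum convergent_fls_mult convY convZ' regular_word_take regular_word_drop)
       (use U w\<^sub>0 in \<open>auto intro: finite_subset\<close>)
  then show ?thesis unfolding NZ[abs_def] .
qed

end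

section \<open>The blocks of a word and the limit\<close>

text \<open>The maximal run of zeros around \<open>i\<close>, or \<open>{i}\<close> if
  \<open>m i \<noteq> 0\<close>; used as a label, so that preserving blocks becomes an equality of
  labels.\<close>

definition zero_block :: "('b::linorder \<Rightarrow> nat) \<Rightarrow> 'b \<Rightarrow> 'b set" where
  "zero_block m i = {j. i = j \<or> (\<forall>l\<in>{min i j..max i j}. m l = 0)}"

lemma zero_block_eq_iff:
  "zero_block m i = zero_block m j \<longleftrightarrow> i = j \<or> (\<forall>l\<in>{min i j..max i j}. m l = 0)"
proof
  assume "zero_block m i = zero_block m j"
  moreover have "j \<in> zero_block m j" by (simp add: zero_block_def)
  ultimately show "i = j \<or> (\<forall>l\<in>{min i j..max i j}. m l = 0)"
    by (auto simp: zero_block_def)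
next
  have *: "zero_block m i \<subseteq> zero_block m j" if "\<forall>l\<in>{min i j..max i j}. m l = 0" for i j
  proof
    fix h assume h: "h \<in> zero_block m i"
    have "m l = 0" if "l \<in> {min j h..max j h}" for l
    proof (cases "l \<in> {min i j..max i j}")
      case False
      then have "l \<in> {min i h..max i h}" using that by (auto simp: min_def max_def split: if_splits)
      moreover have "i \<noteq> h" using that False by (auto simp: min.commute max.commute)
      ultimately show ?thesis using h by (auto simp: zero_block_def)
    qed (use \<open>\<forall>l\<in>{min i j..max i j}. m l = 0\<close> in auto)
    then show "h \<in> zero_block m j" by (simp add: zero_block_def)
  qed
  assume "i = j \<or> (\<forall>l\<in>{min i j..max i j}. m l = 0)"
  then show "zero_block m i = zero_block m j"
    using *[of i j] *[of j i] by (auto simp: min.commute max.commute)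
qed

text \<open>The exponents and arguments are extended to all indices so as to be positive wherever
  they do not come from the given data.\<close>

definition exponent :: "int list \<Rightarrow> nat \<Rightarrow> nat" where
  "exponent s i = (if i < length s then nat (- s ! i) else 1)"

definition argument :: "int list \<Rightarrow> real list \<Rightarrow> nat \<Rightarrow> real" where
  "argument s r i = (if i < length s \<and> 0 < r ! i then r ! i else 1)"

lemma exponent_eq_0_iff:
  assumes "\<forall>x\<in>set s. x \<le> 0"
  shows "exponent s i = 0 \<longleftrightarrow> i < length s \<and> s ! i = 0"
proof (cases "i < length s")
  case True
  then have "s ! i \<le> 0" using assms by simp
  then show ?thesis using True by (auto simp: exponent_def)
qed (simp add: exponent_def)

lemma Sigma_s_eq:
  assumes "\<forall>x\<in>set s. x \<le> 0"
  shows "Sigma_s s = {p. p permutes {..<length s} \<and>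
    (\<forall>i<length s. zero_block (exponent s) (p i) = zero_block (exponent s) i)}"
proof -
  have "(s ! i \<noteq> 0 \<longrightarrow> p i = i) \<and> (s ! i = 0 \<longrightarrow> (\<forall>j. min i (p i) \<le> j \<and> j \<le> max i (p i) \<longrightarrow> s ! j = 0))
     \<longleftrightarrow> zero_block (exponent s) (p i) = zero_block (exponent s) i"
    if "p permutes {..<length s}" "i < length s" for p i
  proof -
    have pi: "p i < length s" using that permutes_in_image[of p "{..<length s}" i] by simp
    have "(\<forall>l\<in>{min (p i) i..max (p i) i}. exponent s l = 0) \<longleftrightarrow>
       (\<forall>j. min i (p i) \<le> j \<and> j \<le> max i (p i) \<longrightarrow> s ! j = 0)"
      unfolding exponent_eq_0_iff[OF assms] using that pi by (auto simp: min.commute max.commute)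
    then show ?thesis unfolding zero_block_eq_iff
      by (metis max.cobounded1 max.idem min.cobounded1 min.idem nle_le)
  qed
  then show ?thesis unfolding Sigma_s_def by blast
qed

lemma bij_betw_permutes_orderings:
  "bij_betw (\<lambda>p. map p [0..<k]) {p. p permutes {..<k} \<and> (\<forall>i<k. c (p i) = c i)} (orderings c {..<k} [0..<k])"
proof (rule bij_betwI')
  fix p q assume p: "p \<in> {p. p permutes {..<k} \<and> (\<forall>i<k. c (p i) = c i)}"
    and q: "q \<in> {p. p permutes {..<k} \<and> (\<forall>i<k. c (p i) = c i)}"
  show "map p [0..<k] = map q [0..<k] \<longleftrightarrow> p = q"
  proof
    assume "map p [0..<k] = map q [0..<k]"
    then have "p i = q i" if "i < k" for i using that by simp
    moreover have "p i = q i" if "\<not> i < k" for i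
      using p q that permutes_not_in[of p "{..<k}" i] permutes_not_in[of q "{..<k}" i] by simp
    ultimately show "p = q" by blast
  qed simp
next
  fix p assume p: "p \<in> {p. p permutes {..<k} \<and> (\<forall>i<k. c (p i) = c i)}"
  then have "p ` {..<k} = {..<k}" "inj_on p {..<k}" by (auto simp: permutes_image intro: permutes_inj_on)
  then show "map p [0..<k] \<in> orderings c {..<k} [0..<k]"
    using p by (auto simp: orderings_def permutations_of_set_def distinct_map atLeast0LessThan)
next
  fix w assume w: "w \<in> orderings c {..<k} [0..<k]"
  then have d: "distinct w" "set w = {..<k}" and c: "map c w = map c [0..<k]"
    by (auto simp: orderings_def permutations_of_set_def)
  have len: "length w = k" using map_eq_imp_length_eq[OF c] by simp
  define p where "p = (\<lambda>i. if i < k then w ! i else i)"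
  have "bij_betw ((!) w) {..<k} {..<k}" by (rule bij_betw_nth) (simp_all add: d len)
  then have "bij_betw p {..<k} {..<k}" using bij_betw_cong[of "{..<k}" p "(!) w"] by (simp add: p_def)
  then have "p permutes {..<k}" by (rule bij_imp_permutes) (simp add: p_def)
  moreover have "c (p i) = c i" if "i < k" for i
  proof -
    have "map c w ! i = map c [0..<k] ! i" by (simp only: c)
    then show ?thesis using that len by (simp add: p_def)
  qed
  moreover have "w = map p [0..<k]" by (rule nth_equalityI) (auto simp: len p_def)
  ultimately show "\<exists>p\<in>{p. p permutes {..<k} \<and> (\<forall>i<k. c (p i) = c i)}. w = map p [0..<k]" by blast
qed

section \<open>The limit within the positive orthant as a filter\<close>

definition zeta_domain :: "int list \<Rightarrow> real \<Rightarrow> real list set" where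
  "zeta_domain s d = {r. length r = length s \<and> (\<forall>x\<in>set r. 0 < x) \<and>
     (\<forall>i<length s. \<bar>r ! i + real_of_int (s ! i)\<bar> < d)}"

definition zeta_filter :: "int list \<Rightarrow> real list filter" where
  "zeta_filter s = (INF d\<in>{0<..}. principal (zeta_domain s d))"

lemma eventually_zeta_filter:
  "eventually P (zeta_filter s) \<longleftrightarrow> (\<exists>d>0. \<forall>r\<in>zeta_domain s d. P r)"
  unfolding zeta_filter_def
proof (subst eventually_INF_base)
  fix d e :: real assume "d \<in> {0<..}" "e \<in> {0<..}"
  then show "\<exists>x\<in>{0<..}. principal (zeta_domain s x) \<le>
      inf (principal (zeta_domain s d)) (principal (zeta_domain s e))"
    by (intro bexI[of _ "min d e"]) (auto simp: zeta_domain_def)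
qed (auto simp: eventually_principal)

lemma tendsto_argument:
  assumes "\<forall>x\<in>set s. x \<le> 0"
  shows "((\<lambda>r. argument s r i) \<longlongrightarrow> real (exponent s i)) (zeta_filter s)"
proof (cases "i < length s")
  case True
  have s: "real (exponent s i) = - real_of_int (s ! i)"
    using True assms by (simp add: exponent_def)
  show ?thesis
  proof (rule tendstoI)
    fix e :: real assume e: "e > 0"
    have "dist (argument s r i) (real (exponent s i)) < e" if "r \<in> zeta_domain s e" for r
    proof -
      have "0 < r ! i" "\<bar>r ! i + real_of_int (s ! i)\<bar> < e"
        using that True by (auto simp: zeta_domain_def)
      then show ?thesis using True by (simp add: argument_def s dist_real_def)
    qed
    then show "eventually (\<lambda>r. dist (argument s r i) (real (exponent s i)) < e) (zeta_filter s)"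
      using e unfolding eventually_zeta_filter by blast
  qed
qed (simp add: argument_def exponent_def)

declare Zminus.simps [simp del]

section \<open>Identification with the regularized zeta values\<close>

context
  fixes s :: "int list"
  assumes s_le_0: "\<forall>x\<in>set s. x \<le> 0"
begin

interpretation positive_words "zeta_filter s" "argument s" "exponent s" "zero_block (exponent s)"
proof
  show "0 < argument s p i" for p i by (simp add: argument_def)
  show "((\<lambda>r. argument s r i) \<longlongrightarrow> real (exponent s i)) (zeta_filter s)" for i
    by (rule tendsto_argument[OF s_le_0])
  show "exponent s i = 0 \<longleftrightarrow> exponent s j = 0" if "zero_block (exponent s) i = zero_block (exponent s) j" for i j
    using that unfolding zero_block_eq_iff by auto
qed

abbreviation letter :: "real list \<Rightarrow> nat \<Rightarrow> int \<times> real" where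
  "letter r i \<equiv> (- int (exponent s i), argument s r i)"

lemma Zbar_letters: "Zbar (map (letter r) w) = Z r w"
  using x_pos by (subst Zbar_eq_merge_sum) (auto simp: Z_def o_def)

text \<open>\<open>Zminus []\<close> is 0 by its recursion, whereas the left Birkhoff factor must be
  1 on the empty word.\<close>

definition counterterm :: "real list \<Rightarrow> nat list \<Rightarrow> complex fls" where
  "counterterm r w = (if w = [] then 1 else Zminus (map (letter r) w))"

text \<open>The cuts before the last one add up to \<open>?G\<close>; the cut at the end adds
  \<open>Zminus\<close>, which is \<open>- Ppart ?G\<close>.\<close>

lemma convolve_counterterm:
  assumes "w \<noteq> []"
  shows "convolve (counterterm r) (Z r) w = Zplus (map (letter r) w)"
proof -
  let ?v = "map (letter r) w"
  let ?G = "Zbar ?v + (\<Sum>j\<in>{1..<length ?v}. Zminus (take j ?v) * Zbar (drop j ?v))"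
  have "{..<length w} = insert 0 {1..<length w}" using assms by auto
  then have "convolve (counterterm r) (Z r) w = counterterm r w +
     (Z r w + (\<Sum>j\<in>{1..<length w}. counterterm r (take j w) * Z r (drop j w)))"
    unfolding convolve_eq by (simp add: counterterm_def Z_def)
  also have "(\<Sum>j\<in>{1..<length w}. counterterm r (take j w) * Z r (drop j w)) =
     (\<Sum>j\<in>{1..<length ?v}. Zminus (take j ?v) * Zbar (drop j ?v))"
    using assms by (intro sum.cong) (auto simp: counterterm_def Zbar_letters take_map drop_map)
  also have "Z r w = Zbar ?v" by (simp only: Zbar_letters)
  also have "counterterm r w = - Ppart ?G"
    unfolding counterterm_def using assms by (subst Zminus.simps) (simp only: if_False)
  finally show ?thesis by (simp only: Zplus_def Let_def add.commute[of "- Ppart ?G"] add_uminus_conv_diff)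
qed

lemma polar_counterterm: "w \<noteq> [] \<Longrightarrow> polar (counterterm r w)"
  unfolding counterterm_def by (subst Zminus.simps) (simp only: if_False polar_uminus_Ppart)

lemma Ppart_Zplus: "Ppart (Zplus w) = 0"
  unfolding Zplus_def Let_def
  by (rule Ppart_eq_0) (simp only: fls_minus_nth fls_prpart_as_fls_nth if_True diff_self)

text \<open>Between consecutive indices there is nothing that could separate two zeros.\<close>

lemma regular_word_upt: "regular_word [0..<k]"
  unfolding regular_word_def successively_conv_nth
  by (auto simp: zero_block_eq_iff min_def max_def le_Suc_eq)

lemma zeta_sym_eq:
  assumes "r \<in> zeta_domain s d"
  shows "zeta_sym s r =
    symmetrize (zero_block (exponent s)) (convolve (counterterm r) (Z r)) {..<length s} [0..<length s] $$ 0"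
proof -
  have len: "length r = length s" using assms by (simp add: zeta_domain_def)
  have letter: "letter r i = (s ! i, r ! i)" if "i < length s" for i
    using that assms s_le_0 by (auto simp: exponent_def argument_def zeta_domain_def)
  have nth: "convolve (counterterm r) (Z r) w $$ 0 = Zplus (map (letter r) w) $$ 0" for w
  proof (cases "w = []")
    case True
    have "Zbar [] = 1" by (subst Zbar_eq_merge_sum) auto
    then show ?thesis by (simp add: True convolve_def counterterm_def Z_def Zplus_def)
  next
    case False
    then show ?thesis by (simp only: convolve_counterterm not_False_eq_True)
  qed
  have "zeta_sym s r = (\<Sum>p\<in>Sigma_s s. Zplus (map (letter r) (map p [0..<length s])) $$ 0)"
    unfolding zeta_sym_def zeta_reg_def
  proof (intro sum.cong refl arg_cong[of _ _ "\<lambda>w. Zplus w $$ 0"])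
    fix p assume p: "p \<in> Sigma_s s"
    have perm: "p permutes {..<length s}"
      and fixed: "\<And>i. i < length s \<Longrightarrow> s ! i \<noteq> 0 \<Longrightarrow> p i = i"
      and zero: "\<And>i j. i < length s \<Longrightarrow> s ! i = 0 \<Longrightarrow> min i (p i) \<le> j \<Longrightarrow> j \<le> max i (p i) \<Longrightarrow> s ! j = 0"
      using p unfolding Sigma_s_def by blast+
    show "zip s (perm_list p r) = map (letter r) (map p [0..<length s])"
    proof (rule nth_equalityI)
      fix i assume "i < length (zip s (perm_list p r))"
      then have i: "i < length s" by (simp add: perm_list_def len)
      have pi: "p i < length s"
        using i permutes_in_image[of p "{..<length s}" i] perm by simp
      \<comment> \<open>\<open>zeta_sym\<close> permutes only the arguments; as \<open>s\<close> is
        constant along \<open>p\<close>, this amounts to permuting whole letters.\<close>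
      have "s ! p i = s ! i"
      proof (cases "s ! i = 0")
        case True
        have "s ! p i = 0" by (rule zero[OF i True]) auto
        then show ?thesis using True by simp
      next
        case False
        then show ?thesis using fixed[OF i] by simp
      qed
      then show "zip s (perm_list p r) ! i = map (letter r) (map p [0..<length s]) ! i"
        using i pi len letter[OF pi] by (simp add: perm_list_def)
    qed (simp add: perm_list_def len)
  qed
  also have "\<dots> = (\<Sum>w\<in>orderings (zero_block (exponent s)) {..<length s} [0..<length s]. Zplus (map (letter r) w) $$ 0)"
    unfolding Sigma_s_eq[OF s_le_0] by (rule sum.reindex_bij_betw[OF bij_betw_permutes_orderings])
  finally show ?thesis unfolding symmetrize_def fls_nth_sum nth .
qed

lemma zeta_sym_tendsto: "\<exists>L. (zeta_sym s \<longlongrightarrow> L) (zeta_filter s)"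
proof -
  have "convergent_fls (zeta_filter s)
    (\<lambda>r. symmetrize (zero_block (exponent s)) (convolve (counterterm r) (Z r)) {..<length s} [0..<length s])"
  proof (rule convergent_symmetrize_birkhoff)
    show "Ppart (convolve (counterterm r) (Z r) w) = 0" if "w \<noteq> []" for r w
      by (simp only: convolve_counterterm[OF that] Ppart_Zplus)
    show "polar (counterterm r w)" if "w \<noteq> []" for r w
      using that by (rule polar_counterterm)
  qed (simp_all add: counterterm_def regular_word_upt)
  then obtain L where "((\<lambda>r. symmetrize (zero_block (exponent s)) (convolve (counterterm r) (Z r)) {..<length s} [0..<length s] $$ 0)
     \<longlongrightarrow> L) (zeta_filter s)"
    unfolding convergent_fls_def by blast
  moreover have "eventually (\<lambda>r. symmetrize (zero_block (exponent s)) (convolve (counterterm r) (Z r)) {..<length s} [0..<length s] $$ 0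
      = zeta_sym s r) (zeta_filter s)"
    unfolding eventually_zeta_filter using zeta_sym_eq[of _ 1] by (intro exI[of _ 1]) auto
  ultimately have "(zeta_sym s \<longlongrightarrow> L) (zeta_filter s)" by (rule Lim_transform_eventually)
  then show ?thesis ..
qed

end

theorem theorem4p12:
  fixes s :: "int list"
  assumes "\<forall>x\<in>set s. x \<le> 0"
  shows "\<exists>L::complex. \<forall>e>0. \<exists>d>0. \<forall>r::real list.
           length r = length s \<and> (\<forall>x\<in>set r. 0 < x) \<and> r \<noteq> map (\<lambda>x. - real_of_int x) s \<and>
           (\<forall>i<length s. \<bar>r ! i + real_of_int (s ! i)\<bar> < d)
           \<longrightarrow> cmod (zeta_sym s r - L) < e"
proof -
  obtain L where L: "(zeta_sym s \<longlongrightarrow> L) (zeta_filter s)"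
    using zeta_sym_tendsto[OF assms] by blast
  show ?thesis
  proof (intro exI[of _ L] allI impI)
    fix e :: real assume "e > 0"
    from tendstoD[OF L this] obtain d
      where d: "d > 0" "\<And>r. r \<in> zeta_domain s d \<Longrightarrow> cmod (zeta_sym s r - L) < e"
      unfolding eventually_zeta_filter dist_norm by blast
    show "\<exists>d>0. \<forall>r. length r = length s \<and> (\<forall>x\<in>set r. 0 < x) \<and> r \<noteq> map (\<lambda>x. - real_of_int x) s \<and>
           (\<forall>i<length s. \<bar>r ! i + real_of_int (s ! i)\<bar> < d) \<longrightarrow> cmod (zeta_sym s r - L) < e"
      by (intro exI[of _ d] conjI allI impI d(1) d(2)) (simp add: zeta_domain_def)
  qed
qed

end
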